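(* Let $n\ge2$. <br>(1) Let $m\ge1$ and let $(j_s,i_s)_{1\le s\le m}$ be any family of integers satisfying the pairwise inequalities. The expression $w=\mathcal B(j_1,i_1)\mathcal B(j_2,i_2)\cdots\mathcal B(j_m,i_m)$ is reduced and affine length reduced, and satisfies $\mathscr R(w)=\{a_{n+1}\}$. <br>(2) Any $w\in W(\tilde A_n)$ with $L(w)=m\ge 1$ can be written uniquely as $$w=\mathcal B(j_1,i_1)\mathcal B(j_2,i_2)\cdots\mathcal B(j_m,i_m)\,x,$$ where $(j_s,i_s)_{1\le s\le m}$ satisfies the pairwise inequalities and $x$ is the canonical reduced expression of an element of $W(A_n)$. Such a form is reduced: $$l(w)=l(x)+\sum_{s=1}^m (n+1+i_s+1-j_s).$$ <br>(3) For any family $(j_s,i_s)_{1\le s\le m}$ satisfying the pairwise inequalities and any $r,s$ between $1$ and $m$: $l(\mathcal B(j_s,i_s))=l(\mathcal B(j_r,i_r))$ if and only if $\mathcal B(j_s,i_s)=\mathcal B(j_r,i_r)$. <br>(4) Specifically, a canonical reduced expression for $w\in W(\tilde A_n)$ with $L(w)=m\ge1$ is given by $$w=\mathcal B(j_1,i_1)\cdots\mathcal B(j_m,i_m)\,\lfloor k_1,l_1\rfloor\lfloor k_2,l_2\rfloor\cdots\lfloor k_t,l_t\rfloor$$ with $(j_s,i_s)_{1\le s\le m}$ satisfying the pairwise inequalities, $t\ge0$, $n\ge l_1>\cdots>l_t\ge1$ and $l_h\ge k_h\ge1$ for $1\le h\le t$.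
   Context: For $n\ge2$, $W(\tilde A_n)$ is the Coxeter group with generating set $S_n=\{\sigma_1,\dots,\sigma_n,a_{n+1}\}$ whose Coxeter graph is the cycle $\sigma_1-\sigma_2-\cdots-\sigma_n-a_{n+1}-\sigma_1$ (all edges of label 3). $W(A_n)$ is the parabolic subgroup generated by $\sigma_1,\dots,\sigma_n$. $l$ is the Coxeter length and $\mathscr R(w)=\{s\in S_n: l(ws)<l(w)\}$. The affine length $L(w)$ is the minimal number of occurrences of $a_{n+1}$ among all reduced expressions of $w$; a reduced expression of $w$ is affine length reduced if $a_{n+1}$ occurs in it exactly $L(w)$ times. Notation (words): $\lfloor i,j\rfloor=\sigma_i\sigma_{i+1}\cdots\sigma_j$ for $1\le i\le j\le n$, $\lfloor n+1,n\rfloor=1$; $\lceil i,j\rceil=\sigma_i\sigma_{i-1}\cdots\sigma_j$ for $n\ge i\ge j\ge1$, $\lceil 0,1\rceil=1$. For $1\le r\le n+1$, $0\le i\le n-1$: $h(r,i)=\lfloor r,n\rfloor\lceil i,1\rceil$ and $\mathcal B(r,i)=h(r,i)a_{n+1}$ (affine brick). The canonical reduced expression of an element of $W(A_n)$ is its unique expression of the form $\lfloor k_1,l_1\rfloor\cdots\lfloor k_t,l_t\rfloor$ with $t\ge0$, $n\ge l_1>\cdots>l_t\ge1$, $l_h\ge k_h\ge1$ (it is a known fact that every element has exactly one such expression and that it is reduced). A family of integers $(j_s,i_s)_{1\le s\le m}$ satisfies the pairwise inequalities if: (i) $1\le j_1\le n+1$ and $0\le i_1\le n-1$; (ii) for $2\le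 s\le m$, either $i_s=0$ and $j_s=1$, or $1\le i_s\le n-1$ and $1\le j_s\le n$; (iii) for $2\le s\le m$, $j_s\le j_{s-1}$ and $i_s\ge i_{s-1}$; (iv) for $2\le s\le m$, if $j_{s-1}>i_{s-1}+1$ then $j_s<j_{s-1}$; (v) for $2\le s\le m$, if $j_s>i_s+1$ then $i_s>i_{s-1}$. *)

theory Defs
  imports "HOL-Algebra.Group" "HOL-Algebra.Generated_Groups"
begin

section \<open>Coxeter groups given by a Coxeter matrix\<close>

text \<open>
  The Coxeter group with generating set \<open>S\<close> and Coxeter matrix \<open>m\<close> is the group presented by
  \<open>S\<close> with the relators \<open>(s t)^(m s t)\<close>.  As \<open>m s s = 1\<close>, the relators include \<open>s s\<close>, so the
  generators are their own inverses and the group is already a quotient of the free monoid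
  \<open>lists S\<close>.  The value \<open>m s t = 0\<close> would stand for an infinite label.
\<close>

inductive_set coxeter_rel :: "'s set \<Rightarrow> ('s \<Rightarrow> 's \<Rightarrow> nat) \<Rightarrow> ('s list \<times> 's list) set"
  for S :: "'s set" and m :: "'s \<Rightarrow> 's \<Rightarrow> nat" where
  relator: "\<lbrakk>s \<in> S; t \<in> S; x \<in> lists S; y \<in> lists S\<rbrakk>
    \<Longrightarrow> (x @ concat (replicate (m s t) [s, t]) @ y, x @ y) \<in> coxeter_rel S m"
| refl: "x \<in> lists S \<Longrightarrow> (x, x) \<in> coxeter_rel S m"
| sym: "(x, y) \<in> coxeter_rel S m \<Longrightarrow> (y, x) \<in> coxeter_rel S m"
| trans: "\<lbrakk>(x, y) \<in> coxeter_rel S m; (y, z) \<in> coxeter_rel S m\<rbrakk> \<Longrightarrow> (x, z) \<in> coxeter_rel S m"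

text \<open>The group element represented by a word; as a set, it consists of all its expressions.\<close>

definition coxeter_class :: "'s set \<Rightarrow> ('s \<Rightarrow> 's \<Rightarrow> nat) \<Rightarrow> 's list \<Rightarrow> 's list set" where
  "coxeter_class S m x = coxeter_rel S m `` {x}"

definition coxeter_group :: "'s set \<Rightarrow> ('s \<Rightarrow> 's \<Rightarrow> nat) \<Rightarrow> 's list set monoid" where
  "coxeter_group S m =
     \<lparr>carrier = lists S // coxeter_rel S m,
      mult = (\<lambda>u v. \<Union>x\<in>u. \<Union>y\<in>v. coxeter_class S m (x @ y)),
      one = coxeter_class S m []\<rparr>"

definition coxeter_length :: "'s list set \<Rightarrow> nat" where
  "coxeter_length w = (LEAST k. \<exists>x\<in>w. length x = k)"

definition right_descents :: "'s set \<Rightarrow> ('s \<Rightarrow> 's \<Rightarrow> nat) \<Rightarrow> 's list set \<Rightarrow> 's set" where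
  "right_descents S m w =
     {s \<in> S. coxeter_length (w \<otimes>\<^bsub>coxeter_group S m\<^esub> coxeter_class S m [s]) < coxeter_length w}"

definition reduced_word :: "'s set \<Rightarrow> ('s \<Rightarrow> 's \<Rightarrow> nat) \<Rightarrow> 's list \<Rightarrow> bool" where
  "reduced_word S m x \<longleftrightarrow> x \<in> lists S \<and> length x = coxeter_length (coxeter_class S m x)"

lemma coxeter_rel_lists:
  assumes "(x, y) \<in> coxeter_rel S m"
  shows "x \<in> lists S \<and> y \<in> lists S"
  using assms
proof (induction rule: coxeter_rel.induct)
  case (relator s t x y)
  then show ?case by (auto split: if_splits)
qed auto

lemma equiv_coxeter_rel: "equiv (lists S) (coxeter_rel S m)"
proof (rule equivI)
  show "coxeter_rel S m \<subseteq> lists S \<times> lists S"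
    by (intro subrelI SigmaI) (drule coxeter_rel_lists, erule conjE, assumption)+
  show "refl_on (lists S) (coxeter_rel S m)"
    by (intro refl_onI coxeter_rel.refl)
  show "sym_on UNIV (coxeter_rel S m)"
    by (rule symI) (rule coxeter_rel.sym)
  show "trans_on UNIV (coxeter_rel S m)"
    by (rule transI) (rule coxeter_rel.trans)
qed

lemma coxeter_rel_append_left:
  assumes "(x, y) \<in> coxeter_rel S m" "z \<in> lists S"
  shows "(z @ x, z @ y) \<in> coxeter_rel S m"
  using assms(1)
proof (induction rule: coxeter_rel.induct)
  case (relator s t x y)
  then show ?case using coxeter_rel.relator[of s S t "z @ x" y m] assms(2) by simp
next
  case (refl x)
  then show ?case using coxeter_rel.refl[of "z @ x" S m] assms(2) by simp
next
  case (sym x y)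
  show ?case by (rule coxeter_rel.sym[OF sym.IH])
next
  case (trans x y w)
  show ?case by (rule coxeter_rel.trans[OF trans.IH])
qed

lemma coxeter_rel_append_right:
  assumes "(x, y) \<in> coxeter_rel S m" "z \<in> lists S"
  shows "(x @ z, y @ z) \<in> coxeter_rel S m"
  using assms(1)
proof (induction rule: coxeter_rel.induct)
  case (relator s t x y)
  then show ?case using coxeter_rel.relator[of s S t x "y @ z" m] assms(2) by simp
next
  case (refl x)
  then show ?case using coxeter_rel.refl[of "x @ z" S m] assms(2) by simp
next
  case (sym x y)
  show ?case by (rule coxeter_rel.sym[OF sym.IH])
next
  case (trans x y w)
  show ?case by (rule coxeter_rel.trans[OF trans.IH])
qed

lemma coxeter_rel_append:
  assumes "(x, x') \<in> coxeter_rel S m" "(y, y') \<in> coxeter_rel S m"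
  shows "(x @ y, x' @ y') \<in> coxeter_rel S m"
proof (rule coxeter_rel.trans)
  show "(x @ y, x' @ y) \<in> coxeter_rel S m"
    by (rule coxeter_rel_append_right[OF assms(1)]) (use coxeter_rel_lists[OF assms(2)] in simp)
  show "(x' @ y, x' @ y') \<in> coxeter_rel S m"
    by (rule coxeter_rel_append_left[OF assms(2)]) (use coxeter_rel_lists[OF assms(1)] in simp)
qed

lemma mem_coxeter_class: "y \<in> coxeter_class S m x \<longleftrightarrow> (x, y) \<in> coxeter_rel S m"
  by (simp add: coxeter_class_def)

lemma coxeter_class_eq_iff:
  assumes "x \<in> lists S" "y \<in> lists S"
  shows "coxeter_class S m x = coxeter_class S m y \<longleftrightarrow> (x, y) \<in> coxeter_rel S m"
  unfolding coxeter_class_def using eq_equiv_class_iff[OF equiv_coxeter_rel assms] .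

lemma carrier_coxeter_group: "carrier (coxeter_group S m) = coxeter_class S m ` lists S"
  by (auto simp: coxeter_group_def quotient_def coxeter_class_def)

lemma one_coxeter_group: "\<one>\<^bsub>coxeter_group S m\<^esub> = coxeter_class S m []"
  by (simp add: coxeter_group_def)

lemma mult_coxeter_class:
  assumes "x \<in> lists S" "y \<in> lists S"
  shows "coxeter_class S m x \<otimes>\<^bsub>coxeter_group S m\<^esub> coxeter_class S m y = coxeter_class S m (x @ y)"
proof -
  have *: "coxeter_class S m (x' @ y') = coxeter_class S m (x @ y)"
    if "x' \<in> coxeter_class S m x" "y' \<in> coxeter_class S m y" for x' y'
  proof -
    have "(x, x') \<in> coxeter_rel S m" "(y, y') \<in> coxeter_rel S m"
      using that by (simp_all add: mem_coxeter_class)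
    then have r: "(x @ y, x' @ y') \<in> coxeter_rel S m"
      by (rule coxeter_rel_append)
    show ?thesis
      using coxeter_class_eq_iff[of "x @ y" S "x' @ y'" m] coxeter_rel_lists[OF r] r by metis
  qed
  have "x \<in> coxeter_class S m x" "y \<in> coxeter_class S m y"
    using assms by (simp_all only: mem_coxeter_class coxeter_rel.refl)
  then have "(\<Union>x'\<in>coxeter_class S m x. \<Union>y'\<in>coxeter_class S m y. coxeter_class S m (x' @ y')) =
      coxeter_class S m (x @ y)"
    using * by blast
  then show ?thesis
    by (simp add: coxeter_group_def)
qed

lemma coxeter_rel_rev_append:
  assumes "\<And>s. s \<in> S \<Longrightarrow> m s s = 1" "x \<in> lists S"
  shows "(rev x @ x, []) \<in> coxeter_rel S m"
  using assms(2)
proof (induction x rule: lists.induct)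
  case Nil
  show ?case using coxeter_rel.refl[of "[]" S m] by simp
next
  case (Cons s x)
  have "(rev x @ concat (replicate (m s s) [s, s]) @ x, rev x @ x) \<in> coxeter_rel S m"
    by (rule coxeter_rel.relator) (use Cons.hyps in \<open>simp_all add: in_lists_conv_set\<close>)
  moreover have "rev x @ concat (replicate (m s s) [s, s]) @ x = rev (s # x) @ s # x"
    using assms(1)[of s] Cons.hyps by simp
  ultimately have "(rev (s # x) @ s # x, rev x @ x) \<in> coxeter_rel S m"
    by simp
  from coxeter_rel.trans[OF this Cons.IH] show ?case .
qed

lemma group_coxeter_group:
  assumes "\<And>s. s \<in> S \<Longrightarrow> m s s = 1"
  shows "group (coxeter_group S m)"
proof (rule groupI)
  fix u assume "u \<in> carrier (coxeter_group S m)"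
  then obtain x where x: "x \<in> lists S" "u = coxeter_class S m x"
    unfolding carrier_coxeter_group by blast
  then have rx: "rev x \<in> lists S" "rev x @ x \<in> lists S"
    by (simp_all add: in_lists_conv_set)
  with x have "coxeter_class S m (rev x) \<otimes>\<^bsub>coxeter_group S m\<^esub> u = coxeter_class S m (rev x @ x)"
    by (simp only: mult_coxeter_class)
  also have "\<dots> = \<one>\<^bsub>coxeter_group S m\<^esub>"
    unfolding one_coxeter_group
    using rx(2) coxeter_rel_rev_append[of S m x, OF _ x(1)] assms
    by (simp add: coxeter_class_eq_iff)
  finally show "\<exists>v\<in>carrier (coxeter_group S m). v \<otimes>\<^bsub>coxeter_group S m\<^esub> u = \<one>\<^bsub>coxeter_group S m\<^esub>"
    unfolding carrier_coxeter_group using rx(1) by blast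
next
  fix u v assume "u \<in> carrier (coxeter_group S m)" "v \<in> carrier (coxeter_group S m)"
  then obtain x y where xy: "x \<in> lists S" "u = coxeter_class S m x" "y \<in> lists S" "v = coxeter_class S m y"
    unfolding carrier_coxeter_group by blast
  then have "x @ y \<in> lists S" by simp
  with xy show "u \<otimes>\<^bsub>coxeter_group S m\<^esub> v \<in> carrier (coxeter_group S m)"
    unfolding carrier_coxeter_group by (metis imageI mult_coxeter_class)
next
  show "\<one>\<^bsub>coxeter_group S m\<^esub> \<in> carrier (coxeter_group S m)"
    unfolding carrier_coxeter_group one_coxeter_group by (intro imageI) simp
next
  fix u v w
  assume "u \<in> carrier (coxeter_group S m)" "v \<in> carrier (coxeter_group S m)"
    "w \<in> carrier (coxeter_group S m)"
  then obtain x y z where xyz: "x \<in> lists S" "y \<in> lists S" "z \<in> lists S"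
    and "u = coxeter_class S m x" "v = coxeter_class S m y" "w = coxeter_class S m z"
    unfolding carrier_coxeter_group by blast
  moreover have "x @ y \<in> lists S" "y @ z \<in> lists S" using xyz by simp_all
  ultimately show "u \<otimes>\<^bsub>coxeter_group S m\<^esub> v \<otimes>\<^bsub>coxeter_group S m\<^esub> w =
      u \<otimes>\<^bsub>coxeter_group S m\<^esub> (v \<otimes>\<^bsub>coxeter_group S m\<^esub> w)"
    by (simp only: mult_coxeter_class append_assoc)
next
  fix u assume "u \<in> carrier (coxeter_group S m)"
  then obtain x where "x \<in> lists S" "u = coxeter_class S m x"
    unfolding carrier_coxeter_group by blast
  then show "\<one>\<^bsub>coxeter_group S m\<^esub> \<otimes>\<^bsub>coxeter_group S m\<^esub> u = u"
    using mult_coxeter_class[of "[]" S x m] by (simp add: one_coxeter_group)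
qed


section \<open>The affine Coxeter group of type A\<close>

text \<open>
  The number \<open>i \<in> {1..n}\<close> stands for the generator \<open>\<sigma>\<^sub>i\<close> and the number \<open>n + 1\<close> for the generator
  \<open>a\<^sub>n\<^sub>+\<^sub>1\<close>, so that the Coxeter graph is the cycle \<open>1 - 2 - \<dots> - n - (n + 1) - 1\<close>.
\<close>

abbreviation gens :: "nat \<Rightarrow> nat set" where
  "gens n \<equiv> {1..n + 1}"

definition cmat :: "nat \<Rightarrow> nat \<Rightarrow> nat \<Rightarrow> nat" where
  "cmat n s t =
     (if s = t then 1
      else if t = s + 1 \<or> s = t + 1 \<or> {s, t} = {1, n + 1} then 3
      else 2)"

abbreviation W_aff :: "nat \<Rightarrow> nat list set monoid" where
  "W_aff n \<equiv> coxeter_group (gens n) (cmat n)"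

abbreviation word_class :: "nat \<Rightarrow> nat list \<Rightarrow> nat list set" where
  "word_class n \<equiv> coxeter_class (gens n) (cmat n)"

abbreviation reduced :: "nat \<Rightarrow> nat list \<Rightarrow> bool" where
  "reduced n \<equiv> reduced_word (gens n) (cmat n)"

abbreviation descR :: "nat \<Rightarrow> nat list set \<Rightarrow> nat set" where
  "descR n \<equiv> right_descents (gens n) (cmat n)"

lemma group_W_aff: "group (W_aff n)"
  by (rule group_coxeter_group) (simp add: cmat_def)

definition W_fin :: "nat \<Rightarrow> nat list set set" where
  "W_fin n = generate (W_aff n) ((\<lambda>i. word_class n [i]) ` {1..n})"

definition affine_length :: "nat \<Rightarrow> nat list set \<Rightarrow> nat" where
  "affine_length n w = (LEAST k. \<exists>x\<in>w. reduced n x \<and> count_list x (n + 1) = k)"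

definition affine_length_reduced :: "nat \<Rightarrow> nat list \<Rightarrow> bool" where
  "affine_length_reduced n x \<longleftrightarrow>
     reduced n x \<and> count_list x (n + 1) = affine_length n (word_class n x)"

text \<open>
  \<open>asc i j\<close> is the word \<open>\<lfloor>i, j\<rfloor>\<close> and \<open>dsc i j\<close> the word \<open>\<lceil>i, j\<rceil>\<close>; in particular
  \<open>asc (n + 1) n = []\<close> and \<open>dsc 0 1 = []\<close>.
\<close>

definition asc :: "nat \<Rightarrow> nat \<Rightarrow> nat list" where
  "asc i j = [i..<j + 1]"

definition dsc :: "nat \<Rightarrow> nat \<Rightarrow> nat list" where
  "dsc i j = rev [j..<i + 1]"

definition hword :: "nat \<Rightarrow> nat \<Rightarrow> nat \<Rightarrow> nat list" where
  "hword n r i = asc r n @ dsc i 1"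

definition brick :: "nat \<Rightarrow> nat \<times> nat \<Rightarrow> nat list" where
  "brick n = (\<lambda>(r, i). hword n r i @ [n + 1])"

abbreviation bricks :: "nat \<Rightarrow> (nat \<times> nat) list \<Rightarrow> nat list" where
  "bricks n ps \<equiv> concat (map (brick n) ps)"

text \<open>
  A family \<open>(j\<^sub>s, i\<^sub>s)\<close> with \<open>1 \<le> s \<le> m\<close> is a list \<open>ps\<close> of length \<open>m\<close>, whose entry number \<open>s\<close>,
  counted from 1, is \<open>ps ! (s - 1)\<close>.  Natural numbers suffice since the conditions imply
  \<open>j\<^sub>s \<ge> 1\<close> and \<open>i\<^sub>s \<ge> 0\<close>.
\<close>

definition pairwise_ineqs :: "nat \<Rightarrow> (nat \<times> nat) list \<Rightarrow> bool" where
  "pairwise_ineqs n ps \<longleftrightarrow>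
     (let m = length ps; j = (\<lambda>s. fst (ps ! (s - 1))); i = (\<lambda>s. snd (ps ! (s - 1))) in
       (1 \<le> m \<longrightarrow> 1 \<le> j 1 \<and> j 1 \<le> n + 1 \<and> i 1 \<le> n - 1) \<and>
       (\<forall>s\<in>{2..m}.
          ((i s = 0 \<and> j s = 1) \<or> (1 \<le> i s \<and> i s \<le> n - 1 \<and> 1 \<le> j s \<and> j s \<le> n)) \<and>
          j s \<le> j (s - 1) \<and> i s \<ge> i (s - 1) \<and>
          (j (s - 1) > i (s - 1) + 1 \<longrightarrow> j s < j (s - 1)) \<and>
          (j s > i s + 1 \<longrightarrow> i s > i (s - 1))))"

text \<open>The index sequences \<open>(k\<^sub>h, l\<^sub>h)\<close> of the canonical expressions \<open>\<lfloor>k\<^sub>1, l\<^sub>1\<rfloor> \<dots> \<lfloor>k\<^sub>t, l\<^sub>t\<rfloor>\<close>.\<close>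

definition canonical_indices :: "nat \<Rightarrow> (nat \<times> nat) list \<Rightarrow> bool" where
  "canonical_indices n kl \<longleftrightarrow>
     sorted_wrt (>) (map snd kl) \<and>
     (\<forall>(k, l)\<in>set kl. 1 \<le> k \<and> k \<le> l \<and> l \<le> n)"

abbreviation ascs :: "(nat \<times> nat) list \<Rightarrow> nat list" where
  "ascs kl \<equiv> concat (map (\<lambda>(k, l). asc k l) kl)"

definition canonical_expression :: "nat \<Rightarrow> nat list set \<Rightarrow> nat list \<Rightarrow> bool" where
  "canonical_expression n u x \<longleftrightarrow>
     word_class n x = u \<and> (\<exists>kl. canonical_indices n kl \<and> x = ascs kl)"

text \<open>\<open>normal_form n w ps x\<close>: the word \<open>bricks n ps @ x\<close> is an expression of \<open>w\<close> of the required form.\<close>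

definition normal_form :: "nat \<Rightarrow> nat list set \<Rightarrow> (nat \<times> nat) list \<Rightarrow> nat list \<Rightarrow> bool" where
  "normal_form n w ps x \<longleftrightarrow>
     length ps = affine_length n w \<and> pairwise_ineqs n ps \<and>
     (\<exists>u\<in>W_fin n. canonical_expression n u x) \<and>
     word_class n (bricks n ps @ x) = w"

end

theory Submission
  imports Defs
begin

text \<open>
  The group acts on integer vectors \<open>v\<^sub>1, \<dots>, v\<^sub>N\<close> with \<open>N = n + 1\<close>: \<open>\<sigma>\<^sub>k\<close> exchanges \<open>v\<^sub>k\<close> and \<open>v\<^sub>k\<^sub>+\<^sub>1\<close>,
  while \<open>a\<^sub>n\<^sub>+\<^sub>1\<close> replaces \<open>v\<^sub>1\<close> by \<open>v\<^sub>N + N\<close> and \<open>v\<^sub>N\<close> by \<open>v\<^sub>1 - N\<close>. On the orbit of \<open>(n, \<dots>, 1, 0)\<close>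
  every generator changes the statistic \<open>\<Sum>\<^sub>i\<^sub><\<^sub>j \<bar>\<lfloor>(v\<^sub>i - v\<^sub>j) / N\<rfloor>\<bar>\<close> by one, with a sign that is
  read off from two entries. Hence two descents of \<open>v\<close> generate a full dihedral string of descents,
  and Matsumoto's argument shows that the action is free on the orbit and that the statistic is the
  Coxeter length.

  Write \<open>v\<^sub>k = N q\<^sub>k + r\<^sub>k\<close> with \<open>0 \<le> r\<^sub>k < N\<close>. The number of occurrences of \<open>a\<^sub>n\<^sub>+\<^sub>1\<close> in an expression of \<open>v\<close> is
  at least \<open>\<Sum>\<^sub>k max 0 q\<^sub>k\<close>. A brick \<open>\<B>(j, i)\<close> exchanges the outer entries, raising one quotient and
  lowering the other, then moves the raised entry from the left to position \<open>i + 1\<close> and the lowered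
  one from the right to position \<open>j\<close>. The pairwise inequalities say precisely that after each
  brick the lowered entry is the last one with \<open>q < 0\<close> and the raised entry is the first one with
  \<open>q > 0\<close>. So the bricks can be read off from \<open>v\<close> one by one until \<open>q = 0\<close>, and the canonical
  expression of the remaining permutation is insertion sort.
\<close>

section \<open>The action on integer vectors\<close>

definition act1 :: "nat \<Rightarrow> nat \<Rightarrow> (nat \<Rightarrow> int) \<Rightarrow> nat \<Rightarrow> int" where
  "act1 n s v =
     (if s = n + 1 then v(1 := v (n + 1) + int (n + 1), n + 1 := v 1 - int (n + 1))
      else v(s := v (s + 1), s + 1 := v s))"

text \<open>\<open>foldr\<close> lets the last letter act first. A letter prefixed to a word is thus
  applied to the vector of that word, and \<open>descent\<close> detects left descents.\<close>

abbreviation act :: "nat \<Rightarrow> nat list \<Rightarrow> (nat \<Rightarrow> int) \<Rightarrow> nat \<Rightarrow> int" where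
  "act n \<equiv> foldr (act1 n)"

text \<open>The condition under which the letter \<open>s\<close> shortens the element whose vector is \<open>v\<close>.\<close>

definition descent :: "nat \<Rightarrow> nat \<Rightarrow> (nat \<Rightarrow> int) \<Rightarrow> bool" where
  "descent n s v \<longleftrightarrow> (if s = n + 1 then v 1 > v (n + 1) + int (n + 1) else v s < v (s + 1))"

definition base_vec :: "nat \<Rightarrow> nat \<Rightarrow> int" where
  "base_vec n k = int (n + 1) - int k"

text \<open>The orbit of \<open>base_vec n\<close>. The values outside \<open>gens n\<close> are junk; fixing them allows to compare vectors as
  functions.\<close>

definition alcove :: "nat \<Rightarrow> (nat \<Rightarrow> int) \<Rightarrow> bool" where
  "alcove n v \<longleftrightarrow>
     inj_on (\<lambda>k. v k mod int (n + 1)) (gens n) \<and>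
     (\<Sum>k\<in>gens n. v k div int (n + 1)) = 0 \<and>
     (\<forall>k. k \<notin> gens n \<longrightarrow> v k = base_vec n k)"

definition pairs :: "nat \<Rightarrow> (nat \<times> nat) set" where
  "pairs n = {(i, j). 1 \<le> i \<and> i < j \<and> j \<le> n + 1}"

text \<open>Shi's count of the hyperplanes that separate an alcove from the fundamental one.\<close>

definition alcove_length :: "nat \<Rightarrow> (nat \<Rightarrow> int) \<Rightarrow> int" where
  "alcove_length n v = (\<Sum>(i, j)\<in>pairs n. \<bar>(v i - v j) div int (n + 1)\<bar>)"

abbreviation rel :: "nat \<Rightarrow> nat list \<Rightarrow> nat list \<Rightarrow> bool" where
  "rel n x y \<equiv> (x, y) \<in> coxeter_rel (gens n) (cmat n)"

section \<open>The generators satisfy the Coxeter relations\<close>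

lemma act1_involution: "n \<ge> 2 \<Longrightarrow> act1 n s (act1 n s v) = v"
  by (auto simp: act1_def fun_eq_iff)

lemma act1_sigma: "s \<le> n \<Longrightarrow> act1 n s v = v(s := v (s + 1), s + 1 := v s)"
  and act1_affine: "act1 n (n + 1) v = v(1 := v (n + 1) + int (n + 1), n + 1 := v 1 - int (n + 1))"
  by (simp_all add: act1_def)

lemma act1_commute:
  assumes "n \<ge> 2" "s \<in> gens n" "t \<in> gens n" "s \<noteq> t" "cmat n s t \<noteq> 3"
  shows "act1 n s (act1 n t v) = act1 n t (act1 n s v)"
proof -
  have ne: "t \<noteq> s + 1" "s \<noteq> t + 1" "\<not> (s = 1 \<and> t = n + 1)" "\<not> (s = n + 1 \<and> t = 1)"
    using assms by (auto simp: cmat_def insert_commute)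
  consider "s \<le> n" "t \<le> n" | "s = n + 1" "t \<le> n" | "s \<le> n" "t = n + 1"
    using assms by fastforce
  then show ?thesis
    using assms(1-4) ne by cases (intro ext; simp add: act1_sigma act1_affine[simplified])+
qed

lemma act1_braid_sigma:
  assumes "s + 1 \<le> n"
  shows "act1 n s (act1 n (s + 1) (act1 n s v)) = act1 n (s + 1) (act1 n s (act1 n (s + 1) v))"
  using assms by (intro ext) (simp add: act1_sigma)

text \<open>Conjugation moves one of the two exchanged places inwards: for \<open>s = 1\<close> both
  sides exchange positions 2 and \<open>n + 1\<close>, for \<open>s = n\<close> positions 1 and
  \<open>n\<close>, with the usual shift by \<open>n + 1\<close>.\<close>

lemma act1_braid_affine:
  assumes "n \<ge> 2" "s = 1 \<or> s = n"
  shows "act1 n s (act1 n (n + 1) (act1 n s v)) = act1 n (n + 1) (act1 n s (act1 n (n + 1) v))"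
  using assms by (intro ext) (auto simp: act1_sigma act1_affine[simplified])

lemma act1_braid:
  assumes "n \<ge> 2" "s \<in> gens n" "t \<in> gens n" "s \<noteq> t" "cmat n s t = 3"
  shows "act1 n s (act1 n t (act1 n s v)) = act1 n t (act1 n s (act1 n t v))"
proof -
  consider "t = s + 1" "t \<le> n" | "s = t + 1" "s \<le> n" | "s = 1 \<or> s = n" "t = n + 1" | "s = n + 1" "t = 1 \<or> t = n"
    using assms by (cases "t = s + 1 \<or> s = t + 1") (auto simp: cmat_def doubleton_eq_iff le_Suc_eq split: if_splits)
  then show ?thesis
    using assms(1) act1_braid_sigma act1_braid_affine by cases metis+
qed

lemma cmat_2_or_3:
  assumes "s \<noteq> t"
  shows "cmat n s t = 2 \<or> cmat n s t = 3"
  using assms by (auto simp: cmat_def)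

lemma act_relator:
  assumes "n \<ge> 2" "s \<in> gens n" "t \<in> gens n"
  shows "act n (concat (replicate (cmat n s t) [s, t])) v = v"
proof (cases "s = t")
  case True
  then show ?thesis using assms by (simp add: cmat_def act1_involution)
next
  case False
  show ?thesis
  proof (cases "cmat n s t = 3")
    case True
    have "act n (concat (replicate (cmat n s t) [s, t])) v
        = act1 n s (act1 n t (act1 n s (act1 n t (act1 n s (act1 n t v)))))"
      using True by (simp add: numeral_3_eq_3)
    also have "\<dots> = v"
      using act1_braid[OF assms False True] assms by (simp add: act1_involution)
    finally show ?thesis .
  next
    case 2: False
    then have "cmat n s t = 2" using cmat_2_or_3[OF False] by blast
    then have "act n (concat (replicate (cmat n s t) [s, t])) v
        = act1 n s (act1 n t (act1 n s (act1 n t v)))"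
      by (simp add: numeral_2_eq_2)
    also have "\<dots> = v"
      using act1_commute[OF assms False 2] assms by (simp add: act1_involution)
    finally show ?thesis .
  qed
qed

text \<open>Makes \<open>act n x (base_vec n)\<close> an invariant of the group element represented
  by \<open>x\<close>.\<close>

lemma act_rel:
  assumes "n \<ge> 2" "rel n x y"
  shows "act n x v = act n y v"
  using assms(2)
proof (induction arbitrary: v rule: coxeter_rel.induct)
  case (relator s t x y)
  then show ?case using act_relator[OF assms(1)] by simp
qed auto

lemma act_rev:
  assumes "n \<ge> 2"
  shows "act n (rev x) (act n x v) = v" "act n x (act n (rev x) v) = v"
  using assms by (induction x arbitrary: v) (simp_all add: act1_involution)

section \<open>The orbit of the base vector\<close>

lemma alcove_base: "alcove n (base_vec n)"
proof -
  have *: "(int (n + 1) - int k) mod int (n + 1) = int (n + 1) - int k \<and>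
      (int (n + 1) - int k) div int (n + 1) = 0" if "k \<in> gens n" for k
    using that by (intro conjI mod_pos_pos_trivial div_pos_pos_trivial) auto
  show ?thesis
    unfolding alcove_def base_vec_def
  proof (intro conjI allI impI refl)
    show "inj_on (\<lambda>k. (int (n + 1) - int k) mod int (n + 1)) (gens n)"
    proof (rule inj_onI)
      fix k l assume "k \<in> gens n" "l \<in> gens n"
        "(int (n + 1) - int k) mod int (n + 1) = (int (n + 1) - int l) mod int (n + 1)"
      then show "k = l" using *[of k] *[of l] by simp
    qed
    show "(\<Sum>k\<in>gens n. (int (n + 1) - int k) div int (n + 1)) = 0"
      using * by (intro sum.neutral) blast
  qed simp
qed

definition swap_pos :: "nat \<Rightarrow> nat \<Rightarrow> nat \<Rightarrow> nat" where
  "swap_pos n s k =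
     (if s = n + 1 then (if k = 1 then n + 1 else if k = n + 1 then 1 else k)
      else if k = s then s + 1 else if k = s + 1 then s else k)"

lemma bij_trans: "s \<in> gens n \<Longrightarrow> bij_betw (swap_pos n s) (gens n) (gens n)"
  by (rule bij_betw_byWitness[where f' = "swap_pos n s"]) (auto simp: swap_pos_def)

lemma act1_mod: "act1 n s v k mod int (n + 1) = v (swap_pos n s k) mod int (n + 1)"
  by (auto simp: act1_def swap_pos_def)

text \<open>Indexed by the position that an entry leaves, not by the one it reaches; hence the
  argument \<open>swap_pos n s k\<close> in \<open>act1_div\<close>.\<close>

definition shift :: "nat \<Rightarrow> nat \<Rightarrow> nat \<Rightarrow> int" where
  "shift n s k = (if s = n + 1 then (if k = 1 then -1 else if k = n + 1 then 1 else 0) else 0)"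

lemma act1_div:
  assumes "n \<ge> 1"
  shows "act1 n s v k div int (n + 1) = v (swap_pos n s k) div int (n + 1) + shift n s (swap_pos n s k)"
proof -
  have "act1 n s v k = v (swap_pos n s k) + int (n + 1) * shift n s (swap_pos n s k)"
    using assms by (simp add: act1_def swap_pos_def shift_def)
  moreover have "int (n + 1) \<noteq> 0" by simp
  ultimately show ?thesis by (metis add.commute div_mult_self2)
qed

lemma alcove_mod:
  assumes "alcove n v" "i \<in> gens n" "j \<in> gens n" "i \<noteq> j"
  shows "(v i - v j) mod int (n + 1) \<noteq> 0"
proof
  assume "(v i - v j) mod int (n + 1) = 0"
  then have "v i mod int (n + 1) = v j mod int (n + 1)"
    by (simp add: mod_eq_dvd_iff mod_eq_0_iff_dvd)
  then show False using assms unfolding alcove_def inj_on_def by blast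
qed

lemma alcove_neq: "alcove n v \<Longrightarrow> i \<in> gens n \<Longrightarrow> j \<in> gens n \<Longrightarrow> i \<noteq> j \<Longrightarrow> v i \<noteq> v j"
  using alcove_mod[of n v i j] by auto

lemma sum_wt: "n \<ge> 1 \<Longrightarrow> s \<in> gens n \<Longrightarrow> (\<Sum>k\<in>gens n. shift n s k) = 0"
proof -
  assume n: "n \<ge> 1"
  have "(\<Sum>k\<in>gens n. shift n s k) = (\<Sum>k\<in>{1, n + 1}. shift n s k)"
    by (rule sum.mono_neutral_right) (auto simp: shift_def)
  also have "\<dots> = 0" using n by (simp add: shift_def)
  finally show ?thesis .
qed

text \<open>Reindexing along \<open>swap_pos\<close> only permutes the residues, and the two shifts
  of the affine letter cancel in the sum of the quotients.\<close>

lemma alcove_act1: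
  assumes "n \<ge> 1" "alcove n v" "s \<in> gens n"
  shows "alcove n (act1 n s v)"
  unfolding alcove_def
proof (intro conjI allI impI)
  have bij: "bij_betw (swap_pos n s) (gens n) (gens n)" by (rule bij_trans[OF assms(3)])
  have "inj_on ((\<lambda>k. v k mod int (n + 1)) \<circ> swap_pos n s) (gens n)"
    using assms(2) bij by (intro comp_inj_on) (auto simp: alcove_def bij_betw_def)
  then show "inj_on (\<lambda>k. act1 n s v k mod int (n + 1)) (gens n)"
    by (simp only: act1_mod comp_def)
  have "(\<Sum>k\<in>gens n. act1 n s v k div int (n + 1)) =
      (\<Sum>k\<in>gens n. v k div int (n + 1) + shift n s k)"
    unfolding act1_div[OF assms(1)] by (rule sum.reindex_bij_betw[OF bij])
  also have "\<dots> = 0"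
    using assms by (simp only: sum.distrib sum_wt alcove_def)
  finally show "(\<Sum>k\<in>gens n. act1 n s v k div int (n + 1)) = 0" .
next
  fix k assume "k \<notin> gens n"
  then show "act1 n s v k = base_vec n k"
    using assms by (auto simp: act1_def alcove_def)
qed

lemma alcove_act: "n \<ge> 1 \<Longrightarrow> alcove n v \<Longrightarrow> x \<in> lists (gens n) \<Longrightarrow> alcove n (act n x v)"
  by (induction x) (auto intro: alcove_act1)

section \<open>Every generator changes the hyperplane count by one\<close>

lemma finite_pairs: "finite (pairs n)"
  by (rule finite_subset[of _ "{0..n+1} \<times> {0..n+1}"]) (auto simp: pairs_def)

lemma neg_div:
  fixes x N :: int
  assumes "N > 0" "x mod N \<noteq> 0"
  shows "(- x) div N = - (x div N) - 1"
  using assms by (simp add: zdiv_zminus1_eq_if)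

text \<open>One pair \<open>p\<close> belongs to the reflection \<open>s\<close>: its floor
  \<open>q\<close> becomes \<open>- q - 1\<close>, or \<open>1 - q\<close> for the affine letter.
  The absolute values at all other pairs are merely permuted.\<close>

lemma len_act1:
  assumes n: "n \<ge> 2" and v: "alcove n v" and s: "s \<in> gens n"
  shows "alcove_length n (act1 n s v) = alcove_length n v + (if descent n s v then -1 else 1)"
proof -
  define N where "N = int (n + 1)"
  have N: "N > 0" by (simp add: N_def)
  have Nk: "(x + N) div N = x div N + 1" "(x + 2 * N) div N = x div N + 2" for x
    using N div_mult_self2[of N x 1] div_mult_self2[of N x 2] by (simp_all add: mult.commute)
  let ?g = "\<lambda>v (i, j). \<bar>(v i - v j) div N\<bar>"
  define p where "p = (if s = n + 1 then (1, n + 1) else (s, s + 1))"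
  \<comment> \<open>An involution on the remaining pairs. Under the affine letter the partner of
    \<open>(1, j)\<close> would be \<open>(n + 1, j)\<close>, which is out of order; it is replaced
    by \<open>(j, n + 1)\<close>.\<close>
  define \<phi> where "\<phi> = (\<lambda>(i, j). if s \<noteq> n + 1 then (swap_pos n s i, swap_pos n s j)
     else if i = 1 then (j, n + 1) else if j = n + 1 then (1, i) else (i, j))"
  have p: "p \<in> pairs n" using s n by (auto simp: p_def pairs_def)
  have \<phi>: "\<phi> q \<in> pairs n - {p}" "\<phi> (\<phi> q) = q" if "q \<in> pairs n - {p}" for q
    using that s n by (auto simp: p_def pairs_def \<phi>_def swap_pos_def split: if_splits)
  have g: "?g (act1 n s v) (\<phi> q) = ?g v q" if q: "q \<in> pairs n - {p}" for q
  proof (cases "s = n + 1")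
    case False
    then show ?thesis using s by (cases q) (auto simp: \<phi>_def act1_sigma swap_pos_def)
  next
    case True
    obtain i j where ij: "q = (i, j)" by fastforce
    have ne: "(v i - v j) mod N \<noteq> 0"
      using q ij alcove_mod[OF v, of i j] by (auto simp: pairs_def N_def)
    \<comment> \<open>Reversing a pair turns the floor \<open>q\<close> into \<open>- q - 1\<close>;
      the shift by \<open>N\<close> turns this into \<open>- q\<close>.\<close>
    have sw: "\<bar>(v j - v i + N) div N\<bar> = \<bar>(v i - v j) div N\<bar>"
      using neg_div[OF N ne] by (simp add: Nk)
    consider "i = 1" "j \<noteq> n + 1" "j > 1" | "i \<noteq> 1" "j = n + 1" "i < n + 1" | "i \<noteq> 1" "j \<noteq> n + 1"
      using q ij True by (auto simp: pairs_def p_def)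
    then show ?thesis
    proof cases
      case 1
      then have "?g (act1 n s v) (\<phi> q) = \<bar>(v j - (v i - N)) div N\<bar>"
        using True ij n by (simp add: \<phi>_def act1_def N_def)
      then show ?thesis using sw ij by (simp add: algebra_simps)
    next
      case 2
      then have "?g (act1 n s v) (\<phi> q) = \<bar>(v j + N - v i) div N\<bar>"
        using True ij n by (simp add: \<phi>_def act1_def N_def)
      then show ?thesis using sw ij by (simp add: algebra_simps)
    next
      case 3
      then show ?thesis using True ij q by (simp add: \<phi>_def act1_def pairs_def)
    qed
  qed
  have rest: "sum (?g v) (pairs n - {p}) = sum (?g (act1 n s v)) (pairs n - {p})"
    by (rule sum.reindex_bij_witness[where i = \<phi> and j = \<phi>]) (erule \<phi> g)+
  have main: "?g (act1 n s v) p = ?g v p + (if descent n s v then -1 else 1)"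
  proof (cases "s = n + 1")
    case False
    define x where "x = v s - v (s + 1)"
    have "x mod N \<noteq> 0" using alcove_mod[OF v, of s "s + 1"] False s by (auto simp: x_def N_def)
    moreover have "?g (act1 n s v) p = \<bar>(- x) div N\<bar>" "?g v p = \<bar>x div N\<bar>"
      using False s by (simp_all add: p_def act1_sigma x_def)
    moreover have "descent n s v \<longleftrightarrow> x div N < 0"
      using False N by (simp add: descent_def x_def neg_imp_zdiv_neg_iff pos_imp_zdiv_neg_iff)
    ultimately show ?thesis using neg_div[OF N, of x] by auto
  next
    case True
    define x where "x = v 1 - v (n + 1)"
    have ne: "x mod N \<noteq> 0" using alcove_mod[OF v, of 1 "n + 1"] n by (auto simp: x_def N_def)
    have "act1 n s v 1 - act1 n s v (n + 1) = - x + 2 * N"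
      using True n by (simp add: act1_def x_def N_def)
    then have "?g (act1 n s v) p = \<bar>(- x + 2 * N) div N\<bar>" "?g v p = \<bar>x div N\<bar>"
      using True by (simp_all only: p_def x_def if_True prod.case simp_thms)
    moreover have "(- x + 2 * N) div N = 1 - x div N"
      using neg_div[OF N ne] by (simp only: Nk)
    moreover have "descent n s v \<longleftrightarrow> x div N \<ge> 1"
    proof -
      have "descent n s v \<longleftrightarrow> x > N" using True by (auto simp: descent_def x_def N_def)
      also have "\<dots> \<longleftrightarrow> x \<ge> N" using ne by (cases "x = N") auto
      also have "\<dots> \<longleftrightarrow> x div N \<ge> 1" using N by (simp add: int_one_le_iff_zero_less pos_imp_zdiv_pos_iff)
      finally show ?thesis .
    qed
    ultimately show ?thesis by auto
  qed
  show ?thesis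
    using rest main sum.remove[OF finite_pairs p, of "?g v"]
      sum.remove[OF finite_pairs p, of "?g (act1 n s v)"]
    unfolding alcove_length_def N_def by linarith
qed

lemma len_nonneg: "alcove_length n v \<ge> 0"
  unfolding alcove_length_def by (rule sum_nonneg) auto

lemma len_base: "alcove_length n (base_vec n) = 0"
  unfolding alcove_length_def
  by (rule sum.neutral) (auto simp: pairs_def base_vec_def intro!: div_pos_pos_trivial)

lemma len_act_le:
  assumes "n \<ge> 2" "x \<in> lists (gens n)"
  shows "alcove_length n (act n x (base_vec n)) \<le> int (length x)"
  using assms(2)
proof (induction x)
  case Nil
  then show ?case by (simp add: len_base)
next
  case (Cons s x)
  then have "alcove n (act n x (base_vec n))" using alcove_act assms(1) alcove_base by simp
  then show ?case using Cons len_act1[OF assms(1), of "act n x (base_vec n)" s] by auto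
qed

text \<open>Without descents the entries decrease strictly and spread over less than
  \<open>N\<close>, so they are \<open>n + 1\<close> consecutive integers. The vanishing sum of
  quotients leaves only the window from \<open>n\<close> down to 0.\<close>

lemma alcove_no_desc:
  assumes n: "n \<ge> 1" and v: "alcove n v" and nd: "\<And>s. s \<in> gens n \<Longrightarrow> \<not> descent n s v"
  shows "v = base_vec n"
proof
  define N where "N = int (n + 1)"
  have N: "N > 0" by (simp add: N_def)
  have step: "v (k + 1) < v k" if "k \<in> {1..n}" for k
    using that nd[of k] alcove_neq[OF v, of k "k + 1"] by (auto simp: descent_def)
  have diff: "v (k + d) + int d \<le> v k" if "1 \<le> k" "k + d \<le> n + 1" for k d
    using that
  proof (induction d)
    case (Suc d)
    then show ?case using step[of "k + d"] by auto
  qed simp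
  have wide: "v 1 < v (n + 1) + N"
  proof -
    have "v 1 - v (n + 1) \<noteq> N" using alcove_mod[OF v, of 1 "n + 1"] n by (auto simp: N_def)
    then show ?thesis using nd[of "n + 1"] by (auto simp: descent_def N_def)
  qed
  have anti: "v l \<le> v k" if "1 \<le> k" "k \<le> l" "l \<le> n + 1" for k l
    using diff[of k "l - k"] that by auto
  have sum0: "(\<Sum>k\<in>gens n. v k div N) = 0" using v by (simp add: alcove_def N_def)
  \<comment> \<open>A negative last entry would push all entries below \<open>N\<close>, so that no
    quotient is positive and one is negative.\<close>
  have last: "v (n + 1) \<ge> 0"
  proof (rule ccontr)
    assume neg: "\<not> ?thesis"
    have "(\<Sum>k\<in>gens n. v k div N) < (\<Sum>k\<in>gens n. 0)"
    proof (rule sum_strict_mono_ex1)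
      show "\<forall>k\<in>gens n. v k div N \<le> 0"
      proof
        fix k assume "k \<in> gens n"
        then have "v k < N" using neg wide anti[of 1 k] by auto
        then have "v k div N \<le> (N - 1) div N" using N by (intro zdiv_mono1) auto
        then show "v k div N \<le> 0" using N by (simp add: div_pos_pos_trivial)
      qed
      show "\<exists>k\<in>gens n. v k div N < 0"
        using neg N by (intro bexI[of _ "n + 1"]) (auto simp: pos_imp_zdiv_neg_iff)
    qed simp
    then show False using sum0 by simp
  qed
  have first: "v 1 < N"
  proof (rule ccontr)
    assume big: "\<not> ?thesis"
    have "(\<Sum>k\<in>gens n. 0) < (\<Sum>k\<in>gens n. v k div N)"
    proof (rule sum_strict_mono_ex1)
      show "\<forall>k\<in>gens n. 0 \<le> v k div N"
        using last anti[of _ "n + 1"] N by (force simp: pos_imp_zdiv_nonneg_iff)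
      show "\<exists>k\<in>gens n. 0 < v k div N"
        using big N by (intro bexI[of _ 1]) (auto simp: pos_imp_zdiv_pos_iff)
    qed simp
    then show False using sum0 by simp
  qed
  fix k
  show "v k = base_vec n k"
  proof (cases "k \<in> gens n")
    case True
    then have "v k \<ge> int (n + 1) - int k" using diff[of k "n + 1 - k"] last by auto
    moreover have "v k \<le> int (n + 1) - int k"
      using True diff[of 1 "k - 1"] first by (auto simp: N_def)
    ultimately show ?thesis by (simp add: base_vec_def)
  qed (use v in \<open>simp add: alcove_def\<close>)
qed

text \<open>Greedy sorting: each descent lowers the statistic until \<open>alcove_no_desc\<close>
  applies, and the letters used spell the word.\<close>

lemma ex_reduced:
  assumes n: "n \<ge> 2" and "alcove n v"
  shows "\<exists>x\<in>lists (gens n). act n x (base_vec n) = v \<and> int (length x) = alcove_length n v"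
  using assms(2)
proof (induction "nat (alcove_length n v)" arbitrary: v rule: less_induct)
  case less
  show ?case
  proof (cases "\<exists>s\<in>gens n. descent n s v")
    case False
    then have "v = base_vec n" using alcove_no_desc[of n v] less.prems n by force
    then show ?thesis by (intro bexI[of _ "[]"]) (auto simp: len_base)
  next
    case True
    then obtain s where s: "s \<in> gens n" "descent n s v" by blast
    let ?u = "act1 n s v"
    have u: "alcove n ?u" using alcove_act1 less.prems s n by simp
    have l: "alcove_length n ?u = alcove_length n v - 1" using len_act1[OF n less.prems s(1)] s by simp
    then obtain x where "x \<in> lists (gens n)" "act n x (base_vec n) = ?u" "int (length x) = alcove_length n ?u"
      using less.hyps[OF _ u] len_nonneg[of n ?u] by fastforce
    then show ?thesis using s n l by (intro bexI[of _ "s # x"]) (auto simp: act1_involution)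
  qed
qed

section \<open>Two descents and the relation between them\<close>

lemma desc_act1_commute:
  assumes "n \<ge> 2" "s \<in> gens n" "t \<in> gens n" "s \<noteq> t" "cmat n s t \<noteq> 3" "descent n t v"
  shows "descent n t (act1 n s v)"
proof -
  have ne: "t \<noteq> s + 1" "s \<noteq> t + 1" "\<not> (s = 1 \<and> t = n + 1)" "\<not> (s = n + 1 \<and> t = 1)"
    using assms by (auto simp: cmat_def insert_commute)
  show ?thesis using assms(1-4,6) ne
    by (auto simp: descent_def act1_def split: if_splits)
qed

text \<open>The two descents say that three entries, after shifting by multiples of
  \<open>n + 1\<close> if the affine letter is involved, are in increasing order; reversing them
  completely takes three descents.\<close>

lemma desc_act1_braid:
  assumes "n \<ge> 2" "s \<in> gens n" "t \<in> gens n" "s \<noteq> t" "cmat n s t = 3" "descent n s v" "descent n t v"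
  shows "descent n t (act1 n s v) \<and> descent n s (act1 n t (act1 n s v))"
proof -
  consider "t = s + 1" "t \<le> n" | "s = t + 1" "s \<le> n" | "s = 1" "t = n + 1" | "s = n" "t = n + 1"
    | "s = n + 1" "t = 1" | "s = n + 1" "t = n"
    using assms by (cases "t = s + 1 \<or> s = t + 1") (auto simp: cmat_def doubleton_eq_iff le_Suc_eq split: if_splits)
  then show ?thesis
    using assms(1,6,7) by cases (simp_all add: descent_def act1_def)
qed

lemma rel_cancel:
  assumes "s \<in> gens n" "z \<in> lists (gens n)"
  shows "rel n (s # s # z) z"
  using coxeter_rel.relator[of s "gens n" s "[]" z "cmat n"] assms by (simp add: cmat_def)

text \<open>The presentation only offers the relator \<open>s t s t\<close>. It is put in front of
  \<open>t s\<close>, and cancelling equal neighbours leaves \<open>s t\<close>;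
  \<open>rel_braid\<close> proceeds alike.\<close>

lemma rel_commute:
  assumes "s \<in> gens n" "t \<in> gens n" "cmat n s t = 2"
  shows "rel n [s, t] [t, s]"
proof -
  have 1: "rel n [s, t, s, t, t, s] [t, s]"
    using coxeter_rel.relator[of s "gens n" t "[]" "[t, s]" "cmat n"] assms by (simp add: numeral_2_eq_2)
  have "rel n ([s, t, s] @ t # t # [s]) ([s, t, s] @ [s])"
    using assms by (intro coxeter_rel_append_left rel_cancel) auto
  moreover have "rel n ([s, t] @ s # s # []) ([s, t] @ [])"
    using assms by (intro coxeter_rel_append_left rel_cancel) auto
  ultimately have "rel n [s, t, s, t, t, s] [s, t]" by (auto intro: coxeter_rel.trans)
  then show ?thesis using 1 by (blast intro: coxeter_rel.trans coxeter_rel.sym)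
qed

lemma rel_braid:
  assumes "s \<in> gens n" "t \<in> gens n" "cmat n s t = 3"
  shows "rel n [s, t, s] [t, s, t]"
proof -
  have 1: "rel n [s, t, s, t, s, t, t, s, t] [t, s, t]"
    using coxeter_rel.relator[of s "gens n" t "[]" "[t, s, t]" "cmat n"] assms
    by (simp add: numeral_3_eq_3)
  have "rel n ([s, t, s, t, s] @ t # t # [s, t]) ([s, t, s, t, s] @ [s, t])"
    using assms by (intro coxeter_rel_append_left rel_cancel) auto
  moreover have "rel n ([s, t, s, t] @ s # s # [t]) ([s, t, s, t] @ [t])"
    using assms by (intro coxeter_rel_append_left rel_cancel) auto
  moreover have "rel n ([s, t, s] @ t # t # []) ([s, t, s] @ [])"
    using assms by (intro coxeter_rel_append_left rel_cancel) auto
  ultimately have "rel n [s, t, s, t, s, t, t, s, t] [s, t, s]"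
    by (auto intro: coxeter_rel.trans)
  then show ?thesis using 1 by (blast intro: coxeter_rel.trans coxeter_rel.sym)
qed

lemma rel_Cons: "rel n x y \<Longrightarrow> s \<in> gens n \<Longrightarrow> rel n (s # x) (s # y)"
  using coxeter_rel_append_left[of x y "gens n" "cmat n" "[s]"] by simp

section \<open>Reduced words\<close>

lemma len_act1_desc:
  assumes "n \<ge> 2" "alcove n v" "s \<in> gens n" "descent n s v"
  shows "alcove n (act1 n s v)" "alcove_length n (act1 n s v) = alcove_length n v - 1"
  using len_act1[OF assms(1-3)] alcove_act1[of n v s] assms by auto

text \<open>Matsumoto's argument. If the first letters \<open>s\<close> and \<open>t\<close> differ,
  both are descents of \<open>v\<close>, so \<open>v\<close> is also reached by words that begin
  with the two sides of the relation between \<open>s\<close> and \<open>t\<close> and share their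
  tail \<open>z\<close>. By induction each given word is related to one of these.\<close>

lemma reduced_words_rel:
  assumes n: "n \<ge> 2"
  shows "\<lbrakk>x \<in> lists (gens n); y \<in> lists (gens n); act n x (base_vec n) = v; act n y (base_vec n) = v;
    int (length x) = alcove_length n v; int (length y) = alcove_length n v\<rbrakk> \<Longrightarrow> rel n x y"
proof (induction "length x" arbitrary: x y v rule: less_induct)
  case less
  have IH: "rel n x' y'"
    if "x' \<in> lists (gens n)" "y' \<in> lists (gens n)" "act n x' (base_vec n) = act n y' (base_vec n)"
      "int (length x') = alcove_length n (act n x' (base_vec n))" "length y' = length x'" "length x' < length x" for x' y'
    using less.hyps[of x' y' "act n y' (base_vec n)"] that by simp
  have len_eq: "length x = length y" using less.prems by simp
  have v: "alcove n v" using alcove_act[of n "base_vec n" x] less.prems n alcove_base by auto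
  \<comment> \<open>A minimal word begins with a descent, since otherwise its tail would be shorter
    than \<open>len_act_le\<close> allows.\<close>
  have first: "descent n r v \<and> act n z (base_vec n) = act1 n r v \<and> int (length z) = alcove_length n (act1 n r v)"
    if "r # z \<in> lists (gens n)" "act n (r # z) (base_vec n) = v" "int (length (r # z)) = alcove_length n v" for r z
  proof -
    have r: "r \<in> gens n" and z: "z \<in> lists (gens n)" using that by auto
    have e: "act n z (base_vec n) = act1 n r v" using that act1_involution[OF n] by auto
    have "alcove_length n (act1 n r v) \<le> int (length z)" using len_act_le[OF n z] e by simp
    then show ?thesis using len_act1[OF n v r] that(3) e by (auto split: if_splits)
  qed
  show ?case
  proof (cases x)
    case Nil
    then show ?thesis using len_eq coxeter_rel.refl[of "[]" "gens n" "cmat n"] by simp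
  next
    case (Cons s x')
    then obtain t y' where y: "y = t # y'" using len_eq by (cases y) auto
    have st: "s \<in> gens n" "t \<in> gens n" and xy': "x' \<in> lists (gens n)" "y' \<in> lists (gens n)"
      using less.prems Cons y by auto
    have fs: "descent n s v" "act n x' (base_vec n) = act1 n s v" "int (length x') = alcove_length n (act1 n s v)"
      and ft: "descent n t v" "act n y' (base_vec n) = act1 n t v" "int (length y') = alcove_length n (act1 n t v)"
      using first[of s x'] first[of t y'] less.prems Cons y by auto
    have ls: "alcove_length n (act1 n s v) = alcove_length n v - 1" "alcove n (act1 n s v)"
      and lt: "alcove_length n (act1 n t v) = alcove_length n v - 1" "alcove n (act1 n t v)"
      using len_act1_desc[OF n v] st fs(1) ft(1) by auto
    show ?thesis
    proof (cases "s = t")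
      case True
      then have "rel n x' y'" using IH[of x' y'] xy' fs ft Cons by simp
      then show ?thesis using rel_Cons True Cons y st by simp
    next
      case ne: False
      show ?thesis
      proof (cases "cmat n s t = 3")
        case True
        then have True': "cmat n t s = 3" by (auto simp: cmat_def insert_commute split: if_splits)
        \<comment> \<open>The common lower end of the two descending strings \<open>s, t, s\<close>
          and \<open>t, s, t\<close> from \<open>v\<close>.\<close>
        define p where "p = act1 n s (act1 n t (act1 n s v))"
        have br: "act1 n s (act1 n t (act1 n s v)) = act1 n t (act1 n s (act1 n t v))"
          by (rule act1_braid[OF n st ne True])
        have d: "descent n t (act1 n s v)" "descent n s (act1 n t (act1 n s v))"
          using desc_act1_braid[OF n st ne True fs(1) ft(1)] by auto
        have l1: "alcove_length n (act1 n t (act1 n s v)) = alcove_length n v - 2" "alcove n (act1 n t (act1 n s v))"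
          using len_act1_desc[OF n ls(2) st(2) d(1)] ls by auto
        have lp: "alcove_length n p = alcove_length n v - 3" "alcove n p"
          using len_act1_desc[OF n l1(2) st(1) d(2)] l1 by (auto simp: p_def)
        obtain z where z: "z \<in> lists (gens n)" "act n z (base_vec n) = p" "int (length z) = alcove_length n p"
          using ex_reduced[OF n lp(2)] by blast
        have ez: "act n (t # s # z) (base_vec n) = act1 n s v" "act n (s # t # z) (base_vec n) = act1 n t v"
          using z(2) n by (simp add: p_def act1_involution, simp add: p_def br act1_involution)
        have A: "rel n x' (t # s # z)"
          by (rule IH) (use xy' st z ez fs ls lp Cons in auto)
        have B: "rel n y' (s # t # z)"
          by (rule IH) (use xy' st z ez ft lt lp ls fs len_eq Cons y in auto)
        have M: "rel n ([s, t, s] @ z) ([t, s, t] @ z)"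
          by (rule coxeter_rel_append_right[OF rel_braid[OF st True] z(1)])
        show ?thesis
          using coxeter_rel.trans[OF rel_Cons[OF A st(1)]
              coxeter_rel.trans[OF M[unfolded append_Cons append_Nil] coxeter_rel.sym[OF rel_Cons[OF B st(2)]]]] Cons y by simp
      next
        case False
        then have c2: "cmat n s t = 2" using cmat_2_or_3[OF ne] by blast
        define p where "p = act1 n t (act1 n s v)"
        have br: "act1 n s (act1 n t v) = act1 n t (act1 n s v)"
          by (rule act1_commute[OF n st ne False])
        have d: "descent n t (act1 n s v)"
          by (rule desc_act1_commute[OF n st ne False ft(1)])
        have lp: "alcove_length n p = alcove_length n v - 2" "alcove n p"
          using len_act1_desc[OF n ls(2) st(2) d(1)] ls by (auto simp: p_def)
        obtain z where z: "z \<in> lists (gens n)" "act n z (base_vec n) = p" "int (length z) = alcove_length n p"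
          using ex_reduced[OF n lp(2)] by blast
        have ez: "act n (t # z) (base_vec n) = act1 n s v" "act n (s # z) (base_vec n) = act1 n t v"
          using z(2) n by (simp add: p_def act1_involution, simp add: p_def br[symmetric] act1_involution)
        have A: "rel n x' (t # z)"
          by (rule IH) (use xy' st z ez fs ls lp Cons in auto)
        have B: "rel n y' (s # z)"
          by (rule IH) (use xy' st z ez ft lt lp ls fs len_eq Cons y in auto)
        have M: "rel n ([s, t] @ z) ([t, s] @ z)"
          by (rule coxeter_rel_append_right[OF rel_commute[OF st c2] z(1)])
        show ?thesis
          using coxeter_rel.trans[OF rel_Cons[OF A st(1)]
              coxeter_rel.trans[OF M[unfolded append_Cons append_Nil] coxeter_rel.sym[OF rel_Cons[OF B st(2)]]]] Cons y by simp
      qed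
    qed
  qed
qed

text \<open>A letter that is no descent lengthens the minimal word of the tail. A descent
  \<open>s\<close> is absorbed by exchange: the minimal word can be chosen to begin with
  \<open>s\<close>.\<close>

lemma rel_reduced_word:
  assumes n: "n \<ge> 2" and "x \<in> lists (gens n)"
  shows "\<exists>r. rel n x r \<and> int (length r) = alcove_length n (act n x (base_vec n))"
  using assms(2)
proof (induction x)
  case Nil
  show ?case using coxeter_rel.refl[of "[]" "gens n" "cmat n"] by (auto simp: len_base intro!: exI[of _ "[]"])
next
  case (Cons s x)
  let ?v = "act n x (base_vec n)"
  have s: "s \<in> gens n" and x: "x \<in> lists (gens n)" using Cons by auto
  obtain r where r: "rel n x r" "int (length r) = alcove_length n ?v" using Cons by auto
  have rl: "r \<in> lists (gens n)" using coxeter_rel_lists[OF r(1)] by simp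
  have vr: "act n r (base_vec n) = ?v" using act_rel[OF n r(1)] by simp
  have v: "alcove n ?v" using alcove_act alcove_base n x by simp
  have sr: "rel n (s # x) (s # r)" by (rule rel_Cons[OF r(1) s])
  show ?case
  proof (cases "descent n s ?v")
    case False
    then show ?thesis using sr r len_act1[OF n v s] by (intro exI[of _ "s # r"]) auto
  next
    case True
    obtain q where q: "q \<in> lists (gens n)" "act n q (base_vec n) = act1 n s ?v"
        "int (length q) = alcove_length n (act1 n s ?v)"
      using ex_reduced[OF n len_act1_desc(1)[OF n v s True]] by blast
    have "rel n r (s # q)"
      by (rule reduced_words_rel[OF n rl _ vr])
        (use q s r n len_act1_desc(2)[OF n v s True] in \<open>auto simp: act1_involution\<close>)
    \<comment> \<open>The new letter cancels against the leading \<open>s\<close> of the exchanged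
      word.\<close>
    then have "rel n (s # r) q"
      using rel_Cons[OF _ s] rel_cancel[OF s q(1)] coxeter_rel.trans by blast
    then show ?thesis using coxeter_rel.trans[OF sr] q by (intro exI[of _ q]) auto
  qed
qed

text \<open>Freeness on the orbit: both words are related to minimal ones, and minimal words with
  the same image are related to each other.\<close>

lemma rel_iff_act:
  assumes n: "n \<ge> 2" and xy: "x \<in> lists (gens n)" "y \<in> lists (gens n)"
  shows "rel n x y \<longleftrightarrow> act n x (base_vec n) = act n y (base_vec n)"
proof
  assume e: "act n x (base_vec n) = act n y (base_vec n)"
  obtain r q where r: "rel n x r" "int (length r) = alcove_length n (act n x (base_vec n))"
    and q: "rel n y q" "int (length q) = alcove_length n (act n y (base_vec n))"
    using rel_reduced_word[OF n] xy by meson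
  have "rel n r q"
    by (rule reduced_words_rel[OF n, where v = "act n x (base_vec n)"])
      (use r q e coxeter_rel_lists[OF r(1)] coxeter_rel_lists[OF q(1)]
        act_rel[OF n r(1), of "base_vec n"] act_rel[OF n q(1), of "base_vec n"] in simp_all)
  then show "rel n x y" by (rule coxeter_rel.trans[OF r(1) coxeter_rel.trans[OF _ coxeter_rel.sym[OF q(1)]]])
qed (rule act_rel[OF n])

lemma word_class_eq_iff:
  assumes "n \<ge> 2" "x \<in> lists (gens n)" "y \<in> lists (gens n)"
  shows "word_class n x = word_class n y \<longleftrightarrow> act n x (base_vec n) = act n y (base_vec n)"
  using rel_iff_act[OF assms] coxeter_class_eq_iff[OF assms(2,3)] by simp

lemma coxeter_length_word_class:
  assumes n: "n \<ge> 2" and x: "x \<in> lists (gens n)"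
  shows "int (coxeter_length (word_class n x)) = alcove_length n (act n x (base_vec n))"
proof -
  let ?l = "nat (alcove_length n (act n x (base_vec n)))"
  have "coxeter_length (word_class n x) = ?l"
    unfolding coxeter_length_def
  proof (rule Least_equality)
    obtain r where "rel n x r" "int (length r) = alcove_length n (act n x (base_vec n))"
      using rel_reduced_word[OF n x] by blast
    then show "\<exists>y\<in>word_class n x. length y = ?l"
      by (intro bexI[of _ r]) (auto simp: mem_coxeter_class)
  next
    fix k assume "\<exists>y\<in>word_class n x. length y = k"
    then obtain y where y: "rel n x y" "length y = k" by (auto simp: mem_coxeter_class)
    then show "?l \<le> k"
      using len_act_le[OF n, of y] act_rel[OF n y(1)] coxeter_rel_lists[OF y(1)] by simp
  qed
  then show ?thesis using len_nonneg by simp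
qed

lemma reduced_iff:
  assumes "n \<ge> 2"
  shows "reduced n x \<longleftrightarrow> x \<in> lists (gens n) \<and> int (length x) = alcove_length n (act n x (base_vec n))"
  unfolding reduced_word_def by (metis coxeter_length_word_class[OF assms] of_nat_eq_iff)

section \<open>Bricks\<close>

text \<open>A certificate of minimal length that can be checked letter by letter;
  \<open>len_up\<close> turns it into a length formula.\<close>

primrec ascending :: "nat \<Rightarrow> nat list \<Rightarrow> (nat \<Rightarrow> int) \<Rightarrow> bool" where
  "ascending n [] v \<longleftrightarrow> True"
| "ascending n (s # x) v \<longleftrightarrow> ascending n x v \<and> \<not> descent n s (act n x v)"

lemma up_append: "ascending n (x @ y) v \<longleftrightarrow> ascending n y v \<and> ascending n x (act n y v)"
  by (induction x) auto

lemma len_up: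
  assumes "n \<ge> 2" "alcove n v" "x \<in> lists (gens n)" "ascending n x v"
  shows "alcove_length n (act n x v) = alcove_length n v + int (length x)"
  using assms(3,4)
proof (induction x)
  case (Cons s x)
  then have "alcove n (act n x v)" using alcove_act assms by simp
  then show ?case using Cons len_act1[OF assms(1), of "act n x v" s] by simp
qed simp

section \<open>Words that move a single entry\<close>

lemma set_asc: "set (asc k l) = {k..l}" by (auto simp: asc_def)
lemma set_dsc: "set (dsc k l) = {l..k}" by (auto simp: dsc_def)

lemma asc_Cons: "k \<le> l \<Longrightarrow> asc k l = k # asc (k + 1) l"
  by (simp add: asc_def upt_conv_Cons)

lemma asc_Nil: "asc (Suc l) l = []"
  by (simp add: asc_def)

lemma dsc_Suc: "dsc (Suc i) 1 = Suc i # dsc i 1"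
  by (simp add: dsc_def)

lemma act_dsc:
  "i \<le> n \<Longrightarrow> act n (dsc i 1) v =
     (\<lambda>k. if 1 \<le> k \<and> k \<le> i then v (k + 1) else if k = i + 1 then v 1 else v k)"
proof (induction i)
  case 0
  then show ?case by (auto simp: dsc_def)
next
  case (Suc i)
  then show ?case by (auto simp: dsc_Suc[simplified] act1_sigma fun_eq_iff)
qed

text \<open>Each letter carries the former first entry one place to the right, past an entry that is
  not larger.\<close>

lemma up_dsc:
  assumes "i \<le> n" "\<And>k. 2 \<le> k \<Longrightarrow> k \<le> i + 1 \<Longrightarrow> v k \<le> v 1"
  shows "ascending n (dsc i 1) v"
  using assms
proof (induction i)
  case 0
  then show ?case by (auto simp: dsc_def)
next
  case (Suc i)
  then have "v (i + 2) \<le> v 1" "ascending n (dsc i 1) v" by auto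
  then show ?case using Suc.prems(1) by (auto simp: dsc_Suc[simplified] descent_def act_dsc[simplified])
qed

lemma act_asc:
  assumes "k \<le> l + 1" "l \<le> n"
  shows "act n (asc k l) v =
     (\<lambda>j. if j = k then v (l + 1) else if k < j \<and> j \<le> l + 1 then v (j - 1) else v j)"
  using assms(1)
proof (induction k rule: inc_induct)
  case base
  then show ?case by (auto simp: asc_Nil)
next
  case (step k)
  then have k: "k \<le> l" "k \<le> n" using assms(2) by auto
  have "act n (asc k l) v = act1 n k (act n (asc (Suc k) l) v)"
    using asc_Cons[OF k(1)] by simp
  also have "\<dots> = (\<lambda>j. if j = k then v (l + 1) else if k < j \<and> j \<le> l + 1 then v (j - 1) else v j)"
    unfolding step.IH act1_sigma[OF k(2)] using k by (intro ext) auto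
  finally show ?case .
qed

text \<open>Each letter carries the entry from position \<open>l + 1\<close> one place to the left,
  past an entry that is not smaller.\<close>

lemma up_asc:
  assumes "k \<le> l + 1" "l \<le> n" "\<And>j. k \<le> j \<Longrightarrow> j \<le> l \<Longrightarrow> v (l + 1) \<le> v j"
  shows "ascending n (asc k l) v"
  using assms(1,3)
proof (induction k rule: inc_induct)
  case base
  then show ?case by (auto simp: asc_Nil)
next
  case (step k)
  then have "v (l + 1) \<le> v k" "ascending n (asc (Suc k) l) v" by auto
  then show ?case using step.hyps assms(2) by (auto simp: asc_Cons descent_def act_asc)
qed

section \<open>Positive quotients bound the number of affine letters\<close>

definition pos_part :: "nat \<Rightarrow> (nat \<Rightarrow> int) \<Rightarrow> int" where
  "pos_part n v = (\<Sum>k\<in>gens n. max 0 (v k div int (n + 1)))"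

lemma pos_act1:
  assumes "n \<ge> 1" "s \<in> gens n"
  shows "pos_part n (act1 n s v) = (\<Sum>k\<in>gens n. max 0 (v k div int (n + 1) + shift n s k))"
  unfolding pos_part_def act1_div[OF assms(1)] by (rule sum.reindex_bij_betw[OF bij_trans[OF assms(2)]])

lemma pos_act1_sigma:
  assumes "n \<ge> 1" "s \<in> {1..n}"
  shows "pos_part n (act1 n s v) = pos_part n v"
proof -
  have "shift n s k = 0" for k using assms by (simp add: shift_def)
  then show ?thesis using pos_act1[of n s v] assms by (simp add: pos_part_def)
qed

lemma pos_act_sigma:
  assumes "n \<ge> 1" "x \<in> lists {1..n}"
  shows "pos_part n (act n x v) = pos_part n v"
  using assms(2) by (induction x) (use pos_act1_sigma[OF assms(1)] in auto)

lemma sum_max_wt: "n \<ge> 1 \<Longrightarrow> (\<Sum>k\<in>gens n. max 0 (shift n (n + 1) k)) = 1"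
proof -
  assume "n \<ge> 1"
  have "(\<Sum>k\<in>gens n. max 0 (shift n (n + 1) k)) = (\<Sum>k\<in>{n + 1}. max 0 (shift n (n + 1) k))"
    by (rule sum.mono_neutral_right) (auto simp: shift_def)
  also have "\<dots> = 1" using \<open>n \<ge> 1\<close> by (simp add: shift_def)
  finally show ?thesis .
qed

lemma pos_act1_affine_le:
  assumes "n \<ge> 1"
  shows "pos_part n (act1 n (n + 1) v) \<le> pos_part n v + 1"
proof -
  have a: "n + 1 \<in> gens n" by simp
  have "pos_part n (act1 n (n + 1) v) \<le>
      (\<Sum>k\<in>gens n. max 0 (v k div int (n + 1)) + max 0 (shift n (n + 1) k))"
    unfolding pos_act1[OF assms a] by (rule sum_mono) auto
  then show ?thesis using sum_max_wt[OF assms] by (simp only: sum.distrib pos_part_def)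
qed

text \<open>The raised quotient is already nonnegative and the lowered one is not positive, so the
  full gain of one is attained.\<close>

lemma pos_act1_affine:
  assumes "n \<ge> 1" "v 1 < int (n + 1)" "v (n + 1) \<ge> 0"
  shows "pos_part n (act1 n (n + 1) v) = pos_part n v + 1"
proof -
  have a: "n + 1 \<in> gens n" by simp
  have q: "v 1 div int (n + 1) < 1" "v (n + 1) div int (n + 1) \<ge> 0"
    using assms zdiv_mono1[of "v 1" "int n" "int (n + 1)"] by (auto simp: div_pos_pos_trivial pos_imp_zdiv_nonneg_iff)
  have "pos_part n (act1 n (n + 1) v) =
      (\<Sum>k\<in>gens n. max 0 (v k div int (n + 1)) + max 0 (shift n (n + 1) k))"
    unfolding pos_act1[OF assms(1) a]
  proof (rule sum.cong[OF HOL.refl])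
    fix k assume "k \<in> gens n"
    then consider "k = 1" | "k = n + 1" | "k \<noteq> 1" "k \<noteq> n + 1" by blast
    then show "max 0 (v k div int (n + 1) + shift n (n + 1) k) =
        max 0 (v k div int (n + 1)) + max 0 (shift n (n + 1) k)"
      by cases (use q assms(1) in \<open>simp_all add: shift_def\<close>)
  qed
  then show ?thesis using sum_max_wt[OF assms(1)] by (simp only: sum.distrib pos_part_def)
qed

text \<open>Only the affine letter changes the multiset of quotients, and it raises a single one of
  them by one.\<close>

lemma pos_act_le:
  assumes "n \<ge> 1" "x \<in> lists (gens n)"
  shows "pos_part n (act n x v) \<le> pos_part n v + int (count_list x (n + 1))"
  using assms(2)
proof (induction x)
  case (Cons s x)
  show ?case
  proof (cases "s = n + 1")
    case True
    then show ?thesis using Cons pos_act1_affine_le[OF assms(1), of "act n x v"] by simp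
  next
    case False
    then show ?thesis using Cons pos_act1_sigma[OF assms(1), of s "act n x v"] by auto
  qed
qed simp

lemma pos_nonneg: "pos_part n v \<ge> 0"
  unfolding pos_part_def by (rule sum_nonneg) auto

text \<open>All quotients are zero. Among the alcove vectors these are the ones reached from
  \<open>base_vec n\<close> by the finite group, as \<open>flat_ascs\<close> and
  \<open>ascs_exist\<close> show.\<close>

definition flat :: "nat \<Rightarrow> (nat \<Rightarrow> int) \<Rightarrow> bool" where
  "flat n v \<longleftrightarrow> (\<forall>k\<in>gens n. 0 \<le> v k \<and> v k < int (n + 1))"

lemma pos_flat: "flat n v \<Longrightarrow> pos_part n v = 0"
  unfolding pos_part_def flat_def by (rule sum.neutral) (auto simp: div_pos_pos_trivial)

text \<open>No quotient is positive and their sum is zero, so none is negative either.\<close>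

lemma flat_if_pos:
  assumes "alcove n v" "pos_part n v = 0"
  shows "flat n v"
proof -
  let ?q = "\<lambda>k. v k div int (n + 1)"
  have "(\<Sum>k\<in>gens n. max 0 (?q k) - ?q k) = 0"
    using assms by (simp only: sum_subtractf pos_part_def alcove_def)
  then have "\<forall>k\<in>gens n. max 0 (?q k) - ?q k = 0"
    by (subst (asm) sum_nonneg_eq_0_iff) auto
  moreover have "\<forall>k\<in>gens n. max 0 (?q k) = 0"
    using assms(2) unfolding pos_part_def by (subst (asm) sum_nonneg_eq_0_iff) auto
  ultimately have q: "?q k = 0" if "k \<in> gens n" for k using that by fastforce
  show ?thesis
    unfolding flat_def
  proof
    fix k assume "k \<in> gens n"
    then show "0 \<le> v k \<and> v k < int (n + 1)"
      using q[of k] div_mult_mod_eq[of "v k" "int (n + 1)"]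
        pos_mod_sign[of "int (n + 1)" "v k"] pos_mod_bound[of "int (n + 1)" "v k"] by simp
  qed
qed

section \<open>The effect of one brick\<close>

text \<open>The position of the raised entry after \<open>\<B>(j, i)\<close>: it is put at \<open>i + 1\<close>, and shifted by one more place
  if the lowered entry is then inserted at some \<open>j \<le> i + 1\<close>.\<close>

definition raised_pos :: "nat \<Rightarrow> nat \<Rightarrow> nat" where
  "raised_pos j i = (if j > i + 1 then i + 1 else i + 2)"

text \<open>An entry is negative if its quotient is, and at least \<open>n + 1\<close> if its
  quotient is positive. The two positions are determined by \<open>v\<close> alone and reveal the
  leading brick.\<close>

definition headed :: "nat \<Rightarrow> nat \<Rightarrow> nat \<Rightarrow> (nat \<Rightarrow> int) \<Rightarrow> bool" where
  "headed n j p v \<longleftrightarrow>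
     j \<in> gens n \<and> p \<in> gens n \<and>
     v j < 0 \<and> (\<forall>k. j < k \<and> k \<le> n + 1 \<longrightarrow> v k \<ge> 0) \<and>
     v p \<ge> int (n + 1) \<and> (\<forall>k. 1 \<le> k \<and> k < p \<longrightarrow> v k < int (n + 1))"

lemma headed_unique:
  assumes "headed n j p v" "headed n j' p' v"
  shows "j = j' \<and> p = p'"
  using assms unfolding headed_def atLeastAtMost_iff
  by (meson linorder_neqE_nat not_less)

text \<open>The raised entry pulls positions up to \<open>i\<close> from the right, the lowered
  entry pushes positions beyond \<open>j\<close> to the right; for \<open>j < k \<le> i + 1\<close>
  the two displacements cancel.\<close>

definition brick_vec :: "nat \<Rightarrow> nat \<Rightarrow> nat \<Rightarrow> (nat \<Rightarrow> int) \<Rightarrow> nat \<Rightarrow> int" where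
  "brick_vec n j i v k =
     (if k = j then v 1 - int (n + 1)
      else if k = raised_pos j i then v (n + 1) + int (n + 1)
      else if k < j then (if 1 \<le> k \<and> k \<le> i then v (k + 1) else v k)
      else if k \<le> n + 1 then (if k \<le> i + 1 then v k else v (k - 1))
      else v k)"

lemma act_dsc_affine:
  assumes "i < n"
  shows "act n (dsc i 1) (act1 n (n + 1) v) =
     (\<lambda>k. if 1 \<le> k \<and> k \<le> i then v (k + 1) else if k = i + 1 then v (n + 1) + int (n + 1)
      else if k = n + 1 then v 1 - int (n + 1) else v k)"
  unfolding act_dsc[OF less_imp_le[OF assms]] act1_affine
  by (rule ext) (use assms in simp)

lemma act_brick:
  assumes "n \<ge> 1" "1 \<le> j" "j \<le> n + 1" "i \<le> n - 1"
  shows "act n (brick n (j, i)) v = brick_vec n j i v"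
proof
  fix k
  have i: "i < n" using assms by simp
  define t where "t = act n (dsc i 1) (act1 n (n + 1) v)"
  have "act n (brick n (j, i)) v = act n (asc j n) t"
    by (simp add: brick_def hword_def t_def)
  then have e: "act n (brick n (j, i)) v k =
      (if k = j then t (n + 1) else if j < k \<and> k \<le> n + 1 then t (k - 1) else t k)"
    using act_asc[OF assms(3) order_refl, of t] by simp
  consider "k = j" | "k \<noteq> j" "k = raised_pos j i" | "k \<noteq> raised_pos j i" "k < j" | "k \<noteq> raised_pos j i" "k > j" "k \<le> n + 1" | "k > n + 1"
    by linarith
  then show "act n (brick n (j, i)) v k = brick_vec n j i v k"
    unfolding e unfolding t_def act_dsc_affine[OF i] brick_vec_def
    using assms i by cases (auto simp: raised_pos_def split: if_splits)
qed

text \<open>The raised entry is at least \<open>n + 1\<close> and passes entries below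
  \<open>n + 1\<close>; the lowered one is negative and passes nonnegative entries. So no letter is
  a descent, and the same bounds give \<open>headed\<close>. The entry \<open>v j\<close> itself is
  passed only if \<open>j > i + 1\<close>: otherwise the first move has replaced it.\<close>

lemma up_brick:
  assumes "n \<ge> 1" "1 \<le> j" "j \<le> n + 1" "i \<le> n - 1"
    and "v 1 < int (n + 1)" "v (n + 1) \<ge> 0"
    and a: "\<And>k. 2 \<le> k \<Longrightarrow> k \<le> i + 1 \<Longrightarrow> v k < int (n + 1)"
    and b: "\<And>k. k \<le> n \<Longrightarrow> k > j \<or> k = j \<and> j > i + 1 \<Longrightarrow> v k \<ge> 0"
  shows "ascending n (brick n (j, i)) v" "headed n j (raised_pos j i) (act n (brick n (j, i)) v)"
    "pos_part n (act n (brick n (j, i)) v) = pos_part n v + 1"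
proof -
  have i: "i \<le> n" and i': "i < n" using assms by auto
  let ?u = "act1 n (n + 1) v"
  let ?t = "act n (dsc i 1) ?u"
  have t: "?t k = (if 1 \<le> k \<and> k \<le> i then v (k + 1) else if k = i + 1 then v (n + 1) + int (n + 1)
      else if k = n + 1 then v 1 - int (n + 1) else v k)" for k
    unfolding act_dsc_affine[OF i'] ..
  have "\<not> descent n (n + 1) v" using assms by (simp add: descent_def)
  moreover have "ascending n (dsc i 1) ?u"
    using assms i by (intro up_dsc) (auto simp: act1_affine[simplified] intro!: order.trans[OF less_imp_le[OF a]])
  moreover have "ascending n (asc j n) ?t"
  proof (rule up_asc)
    fix k assume k: "j \<le> k" "k \<le> n"
    have "?t (n + 1) < 0" using t[of "n + 1"] assms(5) i' by simp
    moreover have "v k \<ge> 0" if "k > i + 1"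
      using that k b[of k] by (cases "j = k") auto
    then have "?t k \<ge> 0"
      unfolding t using k assms(2,6) i' b[of "k + 1"] by auto
    ultimately show "?t (n + 1) \<le> ?t k" by simp
  qed (use assms in auto)
  ultimately show "ascending n (brick n (j, i)) v"
    by (simp add: brick_def hword_def up_append)
  have w: "act n (brick n (j, i)) v = brick_vec n j i v" by (rule act_brick[OF assms(1-4)])
  show "headed n j (raised_pos j i) (act n (brick n (j, i)) v)"
    unfolding w headed_def
  proof (intro conjI allI impI)
    fix k assume k: "j < k \<and> k \<le> n + 1"
    then have "j < k - 1 \<or> k - 1 = j" by linarith
    then have "v (k - 1) \<ge> 0" if "k > i + 1" "k \<noteq> raised_pos j i"
      using that k b[of "k - 1"] by (auto simp: raised_pos_def split: if_splits)
    moreover have "v k \<ge> 0" if "k \<le> i + 1" using that k b[of k] i' by auto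
    ultimately show "brick_vec n j i v k \<ge> 0"
      using k assms(6) by (auto simp: brick_vec_def)
  next
    fix k assume k: "1 \<le> k \<and> k < raised_pos j i"
    then have "v k < int (n + 1)" if "k \<le> i + 1"
      using that a[of k] assms(5) by (cases "k = 1") auto
    then show "brick_vec n j i v k < int (n + 1)"
      using k a[of "k + 1"] assms(5) by (auto simp: brick_vec_def raised_pos_def split: if_splits)
  qed (use assms in \<open>auto simp: brick_vec_def raised_pos_def\<close>)
  have "brick n (j, i) = (asc j n @ dsc i 1) @ [n + 1]" "asc j n @ dsc i 1 \<in> lists {1..n}"
    using assms by (auto simp: brick_def hword_def set_asc set_dsc)
  then have "pos_part n (act n (brick n (j, i)) v) = pos_part n (act1 n (n + 1) v)"
    using pos_act_sigma[OF assms(1), of "asc j n @ dsc i 1" "act1 n (n + 1) v"] by simp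
  then show "pos_part n (act n (brick n (j, i)) v) = pos_part n v + 1"
    using pos_act1_affine[OF assms(1,5,6)] by simp
qed

section \<open>The pairwise inequalities along a list\<close>

lemma pairwise_Nil: "pairwise_ineqs n []"
  by (simp add: pairwise_ineqs_def Let_def)

lemma pairwise_single: "pairwise_ineqs n [(j, i)] \<longleftrightarrow> 1 \<le> j \<and> j \<le> n + 1 \<and> i \<le> n - 1"
  by (simp add: pairwise_ineqs_def Let_def)

text \<open>Recursive form of the indexed conditions. The bounds on \<open>(j', i')\<close> are
  listed separately because this pair heads the tail, where only the weaker condition (i) is imposed
  on it.\<close>

lemma pairwise_Cons:
  assumes "n \<ge> 1"
  shows "pairwise_ineqs n ((j, i) # (j', i') # ps) \<longleftrightarrow>
    1 \<le> j \<and> j \<le> n + 1 \<and> i \<le> n - 1 \<and>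
    ((i' = 0 \<and> j' = 1) \<or> (1 \<le> i' \<and> i' \<le> n - 1 \<and> 1 \<le> j' \<and> j' \<le> n)) \<and>
    j' \<le> j \<and> i \<le> i' \<and> (j > i + 1 \<longrightarrow> j' < j) \<and> (j' > i' + 1 \<longrightarrow> i < i') \<and>
    pairwise_ineqs n ((j', i') # ps)"
proof -
  \<comment> \<open>Index 2 compares the two leading pairs; every later index, lowered by one,
    belongs to the tail.\<close>
  have split: "(\<forall>s\<in>{2..Suc (Suc m)}. P s) \<longleftrightarrow> P 2 \<and> (\<forall>s\<in>{2..Suc m}. P (Suc s))" for P m
  proof -
    have "{2..Suc (Suc m)} = insert 2 (Suc ` {2..Suc m})"
      unfolding image_Suc_atLeastAtMost by auto
    then show ?thesis by (simp only: ball_simps)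
  qed
  have nth: "s \<in> {2..m} \<Longrightarrow> ((j, i) # xs) ! (Suc s - 1) = xs ! (s - 1)"
    "s \<in> {2..m} \<Longrightarrow> ((j, i) # xs) ! (Suc s - 1 - 1) = xs ! (s - 1 - 1)" for s m xs
    by (cases s; simp; cases "s - 1"; simp)+
  show ?thesis
    using assms unfolding pairwise_ineqs_def Let_def list.size add_0_right One_nat_def add_Suc_right split
    by (auto simp: nth_Cons')
qed

section \<open>Reading the normal form off the vector\<close>

lemma pairwise_tl: "n \<ge> 1 \<Longrightarrow> pairwise_ineqs n (p # ps) \<Longrightarrow> pairwise_ineqs n ps"
  by (cases p; cases ps) (auto simp: pairwise_Nil pairwise_Cons)

lemma pairwise_hd:
  assumes "n \<ge> 1" "pairwise_ineqs n ((j, i) # ps)"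
  shows "1 \<le> j" "j \<le> n + 1" "i \<le> n - 1"
  using assms by (cases ps; auto simp: pairwise_single pairwise_Cons)+

text \<open>Bricks are added from the right, starting with the last. The \<open>headed\<close> data
  left by the previous brick and the inequalities between neighbours supply the hypotheses of
  \<open>up_brick\<close>.\<close>

lemma bricks_invariant:
  assumes n: "n \<ge> 1" and flat: "flat n v0"
  shows "pairwise_ineqs n ps \<Longrightarrow>
    ascending n (bricks n ps) v0 \<and> pos_part n (act n (bricks n ps) v0) = int (length ps) \<and>
    (\<forall>j i qs. ps = (j, i) # qs \<longrightarrow> headed n j (raised_pos j i) (act n (bricks n ps) v0))"
proof (induction ps)
  case Nil
  then show ?case using pos_flat[OF flat] by simp
next
  case (Cons p ps)
  obtain j i where p: "p = (j, i)" by (metis surj_pair)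
  let ?v = "act n (bricks n ps) v0"
  have IH: "ascending n (bricks n ps) v0" "pos_part n ?v = int (length ps)"
    "\<And>j i qs. ps = (j, i) # qs \<Longrightarrow> headed n j (raised_pos j i) ?v"
    using Cons.IH pairwise_tl[OF n Cons.prems] by auto
  note b = pairwise_hd[OF n Cons.prems[unfolded p]]
  have hyp: "?v 1 < int (n + 1) \<and> ?v (n + 1) \<ge> 0 \<and> (\<forall>k. 2 \<le> k \<longrightarrow> k \<le> i + 1 \<longrightarrow> ?v k < int (n + 1)) \<and>
      (\<forall>k. k \<le> n \<longrightarrow> k > j \<or> k = j \<and> j > i + 1 \<longrightarrow> ?v k \<ge> 0)"
  proof (cases ps)
    case Nil
    then show ?thesis using flat b n by (auto simp: flat_def)
  next
    case (Cons q qs)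
    obtain j' i' where q: "q = (j', i')" by (metis surj_pair)
    have h: "headed n j' (raised_pos j' i') ?v" using IH(3) Cons q by simp
    have st: "j' \<le> n" "j' \<le> j" "i \<le> i'" "j > i + 1 \<longrightarrow> j' < j" "j' > i' + 1 \<longrightarrow> i < i'"
      using \<open>pairwise_ineqs n (p # ps)\<close> n by (auto simp: p q Cons pairwise_Cons)
    \<comment> \<open>If \<open>j' > i' + 1\<close> the raised entry sits at \<open>i' + 1\<close>
      only, and the strict inequality (v) makes up for the missing place.\<close>
    have "raised_pos j' i' \<ge> i + 2" using st by (auto simp: raised_pos_def)
    then show ?thesis using h st b n by (auto simp: headed_def)
  qed
  have a: "?v k < int (n + 1)" if "2 \<le> k" "k \<le> i + 1" for k using hyp that by blast
  have c: "?v k \<ge> 0" if "k \<le> n" "k > j \<or> k = j \<and> j > i + 1" for k using hyp that by blast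
  note brick = up_brick[OF n b conjunct1[OF hyp] conjunct1[OF conjunct2[OF hyp]] a c]
  show ?case
    using brick IH(1,2) by (simp add: p up_append)
qed

lemma act_inj: "n \<ge> 2 \<Longrightarrow> act n x u = act n x v \<Longrightarrow> u = v"
  by (metis act_rev(1))

text \<open>The value lies below \<open>j\<close> in one case and above \<open>j\<close> in the
  other, so it tells which case occurred.\<close>

lemma fpos_inj: "raised_pos j i = raised_pos j i' \<Longrightarrow> i = i'"
  by (auto simp: raised_pos_def split: if_splits)

text \<open>\<open>pos_part\<close> determines the number of bricks and \<open>headed_unique\<close>
  the first of them, which is then cancelled.\<close>

lemma bricks_unique:
  assumes n: "n \<ge> 2" and flat: "flat n u" "flat n v"
  shows "\<lbrakk>pairwise_ineqs n ps; pairwise_ineqs n qs; act n (bricks n ps) u = act n (bricks n qs) v\<rbrakk>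
    \<Longrightarrow> ps = qs \<and> u = v"
proof (induction ps arbitrary: qs)
  have n_ge_1: "n \<ge> 1" using n by simp
  note inv = bricks_invariant[OF n_ge_1]
  {
    case Nil
    then have "length qs = 0" using inv[OF flat(1), of "[]"] inv[OF flat(2), of qs] by simp
    then show ?case using Nil by simp
  next
    case (Cons p ps)
    then have "length qs = length (p # ps)"
      using inv[OF flat(1), of "p # ps"] inv[OF flat(2), of qs] by simp
    then obtain q qs' where q: "qs = q # qs'" by (cases qs) auto
    obtain j i j' i' where ji: "p = (j, i)" "q = (j', i')" by (metis surj_pair)
    have h: "headed n j (raised_pos j i) (act n (bricks n (p # ps)) u)"
      "headed n j' (raised_pos j' i') (act n (bricks n (p # ps)) u)"
      using inv[OF flat(1), of "p # ps"] inv[OF flat(2), of qs] Cons.prems ji q by auto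
    have pq: "p = q" using headed_unique[OF h] fpos_inj ji by auto
    then have "act n (bricks n ps) u = act n (bricks n qs') v"
      using Cons.prems(3) q act_inj[OF n, of "brick n p"] by simp
    then have "ps = qs' \<and> u = v"
      using Cons.IH[of qs'] Cons.prems q pairwise_tl[OF n_ge_1] by blast
    then show ?case using pq q by simp
  }
qed

text \<open>The last negative entry and the first entry of size at least \<open>n + 1\<close> name a
  brick. Undoing it lowers \<open>pos_part\<close> by one.\<close>

lemma bricks_exist:
  assumes n: "n \<ge> 2"
  shows "alcove n v \<Longrightarrow>
    \<exists>ps u. pairwise_ineqs n ps \<and> alcove n u \<and> flat n u \<and> act n (bricks n ps) u = v"
proof (induction "nat (pos_part n v)" arbitrary: v rule: less_induct)
  case less
  have n_ge_1: "n \<ge> 1" using n by simp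
  let ?N = "int (n + 1)"
  show ?case
  proof (cases "pos_part n v = 0")
    case True
    then show ?thesis using flat_if_pos less.prems
      by (intro exI[of _ "[]"] exI[of _ v]) (simp add: pairwise_Nil)
  next
    case False
    have sum0: "(\<Sum>k\<in>gens n. v k div ?N) = 0" using less.prems by (simp only: alcove_def)
    have ex_pos: "\<exists>k. k \<in> gens n \<and> v k \<ge> ?N"
    proof (rule ccontr)
      assume *: "\<not> ?thesis"
      have "max 0 (v k div ?N) = 0" if "k \<in> gens n" for k
        using that * zdiv_mono1[of "v k" "int n" ?N] by (fastforce simp: div_pos_pos_trivial)
      then show False using False unfolding pos_part_def by (metis (mono_tags, lifting) sum.neutral)
    qed
    \<comment> \<open>Without negative entries \<open>pos_part n v\<close> would be the sum of the
      quotients, which is zero.\<close>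
    have ex_neg: "\<exists>k. k \<in> gens n \<and> v k < 0"
    proof (rule ccontr)
      assume "\<not> ?thesis"
      then have "max 0 (v k div ?N) = v k div ?N" if "k \<in> gens n" for k
        using that by (force simp: pos_imp_zdiv_nonneg_iff max_def)
      then have "pos_part n v = (\<Sum>k\<in>gens n. v k div ?N)"
        unfolding pos_part_def by (intro sum.cong HOL.refl) blast
      then show False using False sum0 by simp
    qed
    define p where "p = (LEAST k. k \<in> gens n \<and> v k \<ge> ?N)"
    define j where "j = (GREATEST k. k \<in> gens n \<and> v k < 0)"
    have p: "p \<in> gens n" "v p \<ge> ?N"
      using LeastI_ex[OF ex_pos] by (simp_all add: p_def)
    have p_least: "v k < ?N" if "1 \<le> k" "k < p" for k
      using not_less_Least[of k "\<lambda>k. k \<in> gens n \<and> v k \<ge> ?N"] that p(1) unfolding p_def[symmetric]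
      by auto
    have j: "j \<in> gens n" "v j < 0"
      using GreatestI_ex_nat[OF ex_neg, of "n + 1"] by (simp_all add: j_def)
    have j_greatest: "v k \<ge> 0" if "j < k" "k \<le> n + 1" for k
      using Greatest_le_nat[of "\<lambda>k. k \<in> gens n \<and> v k < 0" k "n + 1"] that j(1) unfolding j_def[symmetric]
      by force
    have pj: "p \<noteq> j" using p j by auto
    \<comment> \<open>The inverse of \<open>raised_pos j\<close>, which never takes the value
      \<open>j\<close>.\<close>
    define i where "i = (if p < j then p - 1 else p - 2)"
    have fp: "raised_pos j i = p" using pj p j by (auto simp: raised_pos_def i_def)
    have b: "1 \<le> j" "j \<le> n + 1" "i \<le> n - 1" using p j pj by (auto simp: i_def)
    define v' where "v' = act n (rev (brick n (j, i))) v"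
    have vv': "act n (brick n (j, i)) v' = v" using act_rev(2)[OF n] by (simp add: v'_def)
    then have brick_vec: "v k = brick_vec n j i v' k" for k using act_brick[OF n_ge_1 b, of v'] by simp
    have "brick n (j, i) \<in> lists (gens n)"
      using b by (auto simp: brick_def hword_def set_asc set_dsc)
    then have al: "alcove n v'"
      unfolding v'_def by (intro alcove_act[OF n_ge_1 less.prems]) (simp add: in_lists_conv_set)
    \<comment> \<open>The negative entry at \<open>j\<close> is \<open>v' 1 - ?N\<close>, and the
      large one at \<open>p\<close> is \<open>v' (n + 1) + ?N\<close>.\<close>
    have 1: "v' 1 < ?N" using brick_vec[of j] j(2) by (simp add: brick_vec_def)
    have 2: "v' (n + 1) \<ge> 0" using brick_vec[of p] p(2) pj by (simp add: brick_vec_def fp)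
    \<comment> \<open>The bounds \<open>a\<close> and \<open>c\<close> carry the minimality of
      \<open>p\<close> and the maximality of \<open>j\<close> back to \<open>v'\<close>.\<close>
    have a: "v' k < ?N" if "2 \<le> k" "k \<le> i + 1" for k
    proof (cases "k \<le> j")
      case True
      then have "v (k - 1) = v' k" using that brick_vec[of "k - 1"] fp by (auto simp: brick_vec_def raised_pos_def split: if_splits)
      then show ?thesis using p_least[of "k - 1"] that fp by (auto simp: raised_pos_def split: if_splits)
    next
      case False
      then have "p = i + 2" using that fp by (auto simp: raised_pos_def split: if_splits)
      then show ?thesis using that brick_vec[of k] b False p_least[of k] fp by (auto simp: brick_vec_def split: if_splits)
    qed
    have c: "v' k \<ge> 0" if "k \<le> n" "k > j \<or> k = j \<and> j > i + 1" for k
    proof (cases "k \<le> i + 1")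
      case True
      then have "v k = v' k" using that brick_vec[of k] fp by (auto simp: brick_vec_def raised_pos_def split: if_splits)
      then show ?thesis using that True j_greatest[of k] by auto
    next
      case False
      then have "v (k + 1) = v' k" using that brick_vec[of "k + 1"] fp by (auto simp: brick_vec_def raised_pos_def split: if_splits)
      then show ?thesis using that j_greatest[of "k + 1"] by auto
    qed
    have "pos_part n v = pos_part n v' + 1"
      using up_brick(3)[OF n_ge_1 b 1 2 a c] vv' by simp
    then obtain ps u where ps: "pairwise_ineqs n ps" "alcove n u" "flat n u" "act n (bricks n ps) u = v'"
      using less.hyps[OF _ al] pos_nonneg[of n v'] by auto
    \<comment> \<open>Converse of the step in \<open>bricks_invariant\<close>: the entries of
      \<open>v'\<close> at \<open>j'\<close> and \<open>raised_pos j' i'\<close> violate the bounds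
      in \<open>c\<close> and \<open>a\<close>, so these positions lie outside the ranges covered
      there.\<close>
    have "pairwise_ineqs n ((j, i) # ps)"
    proof (cases ps)
      case Nil
      then show ?thesis using b by (simp add: pairwise_single)
    next
      case (Cons q qs)
      obtain j' i' where q: "q = (j', i')" by (metis surj_pair)
      have h: "headed n j' (raised_pos j' i') v'"
        using bricks_invariant[OF n_ge_1 ps(3,1)] ps(4) Cons q by simp
      have b': "1 \<le> j'" "j' \<le> n + 1" "i' \<le> n - 1"
        using pairwise_hd[OF n_ge_1, of j' i' qs] ps(1) Cons q by auto
      have j': "v' j' < 0" and p': "v' (raised_pos j' i') \<ge> ?N" "raised_pos j' i' \<ge> 1"
        using h by (auto simp: headed_def)
      have "j' \<noteq> n + 1" using j' 2 by auto
      then have jn: "j' \<le> n" using b' by simp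
      have "\<not> (j' > j \<or> j' = j \<and> j > i + 1)" using c[OF jn] j' by linarith
      \<comment> \<open>Rules out \<open>i' = 0\<close> with \<open>j' > 1\<close>, as condition
        (ii) demands.\<close>
      moreover have "raised_pos j' i' \<noteq> 1" using p' 1 by auto
      then have p2: "raised_pos j' i' \<ge> 2" using p' by simp
      have "raised_pos j' i' \<ge> i + 2" using a[OF p2] p' by linarith
      ultimately show ?thesis
        using b b' jn p2 n_ge_1 ps(1) unfolding Cons q pairwise_Cons[OF n_ge_1]
        by (auto simp: raised_pos_def split: if_splits)
    qed
    then show ?thesis using ps vv' by (intro exI[of _ "(j, i) # ps"] exI[of _ u]) simp
  qed
qed

section \<open>Canonical words as insertion sort\<close>

lemma canonical_Cons:
  "canonical_indices n ((k, l) # kl) \<longleftrightarrow>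
     1 \<le> k \<and> k \<le> l \<and> l \<le> n \<and> (\<forall>(k', l')\<in>set kl. l' < l) \<and> canonical_indices n kl"
  by (auto simp: canonical_indices_def)

lemma canonical_Nil: "canonical_indices n []"
  by (simp add: canonical_indices_def)

text \<open>The word only permutes positions 1 to \<open>m + 1\<close>. The arbitrary predicate
  \<open>Q\<close> expresses that no new values appear there.\<close>

lemma act_ascs:
  assumes "m \<le> n" "\<forall>(k, l)\<in>set kl. 1 \<le> k \<and> k \<le> l \<and> l \<le> m"
  shows "\<And>j. j > m + 1 \<Longrightarrow> act n (ascs kl) v j = v j"
    and "(\<And>j. 1 \<le> j \<Longrightarrow> j \<le> m + 1 \<Longrightarrow> Q (v j)) \<Longrightarrow>
      (\<And>j. 1 \<le> j \<Longrightarrow> j \<le> m + 1 \<Longrightarrow> Q (act n (ascs kl) v j))"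
proof -
  have *: "(\<forall>j > m + 1. act n (ascs kl) v j = v j) \<and>
    ((\<forall>j. 1 \<le> j \<longrightarrow> j \<le> m + 1 \<longrightarrow> Q (v j)) \<longrightarrow>
      (\<forall>j. 1 \<le> j \<longrightarrow> j \<le> m + 1 \<longrightarrow> Q (act n (ascs kl) v j)))"
    using assms(2)
  proof (induction kl)
    case (Cons p kl)
    obtain k l where p: "p = (k, l)" by (cases p)
    have kl: "1 \<le> k" "k \<le> l + 1" "l \<le> n" "l \<le> m" using Cons.prems assms(1) p by auto
    show ?case using Cons kl by (auto simp: p act_asc[OF kl(2,3)])
  qed simp
  then show "\<And>j. j > m + 1 \<Longrightarrow> act n (ascs kl) v j = v j"
    and "(\<And>j. 1 \<le> j \<Longrightarrow> j \<le> m + 1 \<Longrightarrow> Q (v j)) \<Longrightarrow>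
      (\<And>j. 1 \<le> j \<Longrightarrow> j \<le> m + 1 \<Longrightarrow> Q (act n (ascs kl) v j))"
    by blast+
qed

lemma canonical_lists: "canonical_indices n kl \<Longrightarrow> ascs kl \<in> lists {1..n}"
  by (fastforce simp: canonical_indices_def set_asc in_lists_conv_set)

lemma lists_sigma_gens: "x \<in> lists {1..n} \<Longrightarrow> x \<in> lists (gens n)"
  by (auto simp: in_lists_conv_set)

lemma flat_ascs:
  assumes "canonical_indices n kl"
  shows "flat n (act n (ascs kl) (base_vec n))"
  unfolding flat_def
  using act_ascs(2)[of n n kl "\<lambda>x. 0 \<le> x \<and> x < int (n + 1)" "base_vec n"] assms
  by (auto simp: canonical_indices_def base_vec_def)

text \<open>The later factors do not reach position \<open>l + 1\<close>, so the leading one inserts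
  its base value, the smallest among the first \<open>l + 1\<close> entries, at position
  \<open>k\<close>.\<close>

lemma ascs_Cons:
  assumes "canonical_indices n ((k, l) # kl)"
  shows "ascending n (asc k l) (act n (ascs kl) (base_vec n))"
    and "act n (ascs ((k, l) # kl)) (base_vec n) k = base_vec n (l + 1)"
    and "j > l + 1 \<Longrightarrow> act n (ascs ((k, l) # kl)) (base_vec n) j = base_vec n j"
proof -
  let ?u = "act n (ascs kl) (base_vec n)"
  have kl: "1 \<le> k" "k \<le> l" "l \<le> n" and rest: "\<forall>(k', l')\<in>set kl. 1 \<le> k' \<and> k' \<le> l' \<and> l' \<le> l - 1"
    using assms by (auto simp: canonical_Cons canonical_indices_def)
  then have m: "l - 1 \<le> n" "l - 1 + 1 = l" by auto
  have high: "?u j = base_vec n j" if "j > l" for j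
    using act_ascs(1)[OF m(1) rest, of j] that m(2) by simp
  have low: "?u j \<ge> base_vec n l" if "1 \<le> j" "j \<le> l" for j
    using act_ascs(2)[OF m(1) rest, of "\<lambda>x. x \<ge> base_vec n l" "base_vec n"] that unfolding m(2)
    by (auto simp: base_vec_def)
  show "ascending n (asc k l) ?u"
  proof (rule up_asc)
    fix j assume "k \<le> j" "j \<le> l"
    then show "?u (l + 1) \<le> ?u j" using kl low[of j] high[of "l + 1"] by (simp add: base_vec_def)
  qed (use kl in auto)
  have e: "act n (ascs ((k, l) # kl)) (base_vec n) = act n (asc k l) ?u" by simp
  show "act n (ascs ((k, l) # kl)) (base_vec n) k = base_vec n (l + 1)"
    unfolding e using kl high[of "l + 1"] by (simp add: act_asc)
  show "act n (ascs ((k, l) # kl)) (base_vec n) j = base_vec n j" if "j > l + 1"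
    unfolding e using kl high[of j] that by (simp add: act_asc)
qed

lemma up_ascs: "canonical_indices n kl \<Longrightarrow> ascending n (ascs kl) (base_vec n)"
proof (induction kl)
  case (Cons p kl)
  then show ?case
    using ascs_Cons(1)[of n "fst p" "snd p" kl] canonical_Cons[of n "fst p" "snd p" kl]
    by (cases p) (simp add: up_append)
qed simp

lemma alcove_ascs: "n \<ge> 1 \<Longrightarrow> canonical_indices n kl \<Longrightarrow> alcove n (act n (ascs kl) (base_vec n))"
  using alcove_act alcove_base canonical_lists lists_sigma_gens by blast

lemma alcove_inj: "alcove n v \<Longrightarrow> v i = v j \<Longrightarrow> i \<in> gens n \<Longrightarrow> j \<in> gens n \<Longrightarrow> i = j"
  using alcove_neq by blast

text \<open>The leading pair is visible in the vector: \<open>l + 1\<close> is the last displaced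
  position, and \<open>k\<close> is where its base value went.\<close>

lemma ascs_unique:
  assumes n: "n \<ge> 2"
  shows "\<lbrakk>canonical_indices n kl; canonical_indices n kl';
    act n (ascs kl) (base_vec n) = act n (ascs kl') (base_vec n)\<rbrakk> \<Longrightarrow> kl = kl'"
proof (induction kl arbitrary: kl')
  have moved: "act n (ascs ((k, l) # r)) (base_vec n) (l + 1) \<noteq> base_vec n (l + 1)"
    if c: "canonical_indices n ((k, l) # r)" for k l r
  proof
    let ?v = "act n (ascs ((k, l) # r)) (base_vec n)"
    assume f: "?v (l + 1) = base_vec n (l + 1)"
    have kl: "1 \<le> k" "k \<le> l" "l \<le> n" using c by (auto simp: canonical_Cons)
    have "alcove n ?v" using alcove_ascs[OF _ c] n by simp
    moreover have "?v k = ?v (l + 1)" using ascs_Cons(2)[OF c] f by metis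
    ultimately have "k = l + 1" by (rule alcove_inj) (use kl in auto)
    then show False using kl by simp
  qed
  {
    case Nil
    show ?case
    proof (cases kl')
      case (Cons p r)
      obtain k l where p: "p = (k, l)" by (cases p)
      have kl': "kl' = (k, l) # r" using Cons p by simp
      have "canonical_indices n ((k, l) # r)" using Nil(2) unfolding kl' .
      moreover have "act n (ascs ((k, l) # r)) (base_vec n) = base_vec n" using Nil(3)[symmetric] unfolding kl' by simp
      ultimately show ?thesis using moved[of k l r] by metis
    qed simp
  next
    case (Cons p r)
    obtain k l where p: "p = (k, l)" by (cases p)
    let ?v = "act n (ascs (p # r)) (base_vec n)"
    have c: "canonical_indices n ((k, l) # r)" using Cons.prems p by simp
    show ?case
    proof (cases kl')
      case Nil
      then have "?v = base_vec n" using Cons.prems(3) by simp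
      then show ?thesis using moved[OF c] p by metis
    next
      case kl': (Cons p' r')
      obtain k' l' where p': "p' = (k', l')" by (metis surj_pair)
      have c': "canonical_indices n ((k', l') # r')" using Cons.prems kl' p' by simp
      have v': "?v = act n (ascs ((k', l') # r')) (base_vec n)" using Cons.prems(3) kl' p' by simp
      have v: "?v = act n (ascs ((k, l) # r)) (base_vec n)" using p by simp
      have "\<not> l < l'" using moved[OF c', folded v'] ascs_Cons(3)[OF c, folded v, of "l' + 1"] by auto
      moreover have "\<not> l' < l" using moved[OF c, folded v] ascs_Cons(3)[OF c', folded v', of "l + 1"] by auto
      ultimately have l: "l = l'" by simp
      have "?v k = ?v k'" using ascs_Cons(2)[OF c, folded v] ascs_Cons(2)[OF c', folded v'] l by metis
      moreover have "alcove n ?v" using alcove_ascs[OF _ c, folded v] n by simp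
      ultimately have k: "k = k'"
        using alcove_inj[of n ?v k k'] c c' by (auto simp: canonical_Cons)
      have "act n (ascs r) (base_vec n) = act n (ascs r') (base_vec n)"
        by (rule act_inj[OF n, of "asc k l"]) (use v v' k l in simp)
      then have "r = r'" using Cons.IH[of r'] c c' by (simp add: canonical_Cons)
      then show ?thesis using p p' k l kl' by simp
    qed
  }
qed

lemma flat_surj:
  assumes "alcove n v" "flat n v"
  shows "v ` gens n = {0..int n}"
proof (rule card_subset_eq)
  show "v ` gens n \<subseteq> {0..int n}" using assms(2) by (auto simp: flat_def)
  have "inj_on v (gens n)" using alcove_inj[OF assms(1)] by (auto intro: inj_onI)
  then show "card (v ` gens n) = card {0..int n}" by (simp add: card_image)
qed simp

text \<open>Insertion sort from the right, where positions beyond \<open>m\<close> are already in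
  order. The bound \<open>l < m\<close> keeps the indices \<open>l\<close> strictly
  decreasing.\<close>

lemma ascs_exist:
  assumes n: "n \<ge> 2"
  shows "\<lbrakk>m \<le> n + 1; alcove n v; flat n v; \<And>j. j > m \<Longrightarrow> v j = base_vec n j\<rbrakk> \<Longrightarrow>
    \<exists>kl. canonical_indices n kl \<and> (\<forall>(k, l)\<in>set kl. l < m) \<and> act n (ascs kl) (base_vec n) = v"
proof (induction m arbitrary: v)
  case 0
  have "v j = base_vec n j" for j using 0 by (cases "j = 0") (auto simp: alcove_def)
  then show ?case by (intro exI[of _ "[]"]) (auto simp: canonical_Nil)
next
  case (Suc m)
  have m: "m \<le> n" using Suc.prems by simp
  have "base_vec n (Suc m) \<in> v ` gens n"
    unfolding flat_surj[OF Suc.prems(2,3)] using m by (auto simp: base_vec_def)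
  then obtain k where k: "k \<in> gens n" "v k = base_vec n (Suc m)" by auto
  have "k \<le> Suc m" using Suc.prems(4)[of k] k by (cases "k > Suc m") (auto simp: base_vec_def)
  then consider "k = Suc m" | "k \<le> m" by linarith
  then show ?case
  proof cases
    case 1
    have "v j = base_vec n j" if "j > m" for j using that Suc.prems(4)[of j] 1 k by (cases "j = Suc m") auto
    then obtain kl where "canonical_indices n kl" "\<forall>(k, l)\<in>set kl. l < m" "act n (ascs kl) (base_vec n) = v"
      using Suc.IH[of v] Suc.prems m by auto
    then show ?thesis by (intro exI[of _ kl]) force
  next
    case 2
    \<comment> \<open>Brings the value that belongs to position \<open>m + 1\<close> home from
      position \<open>k\<close>.\<close>
    define u where "u = act n (rev (asc k m)) v"
    have vu: "act n (asc k m) u = v" using act_rev(2)[OF n] by (simp add: u_def)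
    then have v: "v j = (if j = k then u (m + 1) else if k < j \<and> j \<le> m + 1 then u (j - 1) else u j)" for j
      using act_asc[of k m n u] 2 m by auto
    have u: "u j = (if j = m + 1 then v k else if k \<le> j \<and> j \<le> m then v (j + 1) else v j)" for j
      using v[of k] v[of "j + 1"] v[of j] 2 by auto
    have "alcove n u" unfolding u_def
      by (intro alcove_act) (use n Suc.prems k m in \<open>auto simp: set_asc\<close>)
    moreover have "flat n u" using Suc.prems(3) k m by (auto simp: flat_def u base_vec_def)
    moreover have "u j = base_vec n j" if "j > m" for j
      using that Suc.prems(4)[of j] k 2 by (simp add: u)
    ultimately obtain kl where kl: "canonical_indices n kl" "\<forall>(k, l)\<in>set kl. l < m"
        "act n (ascs kl) (base_vec n) = u"
      using Suc.IH[of u] m by auto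
    have "canonical_indices n ((k, m) # kl)" using kl 2 k m by (auto simp: canonical_Cons)
    moreover have "\<forall>(k, l)\<in>set ((k, m) # kl). l < Suc m" using kl(2) by force
    ultimately show ?thesis using kl(3) vu by (intro exI[of _ "(k, m) # kl"]) simp
  qed
qed

section \<open>Normal forms of group elements\<close>

lemma bricks_lists:
  assumes "n \<ge> 1" "pairwise_ineqs n ps"
  shows "bricks n ps \<in> lists (gens n)"
  using assms(2)
proof (induction ps)
  case (Cons p ps)
  obtain j i where p: "p = (j, i)" by (cases p)
  have "1 \<le> j" "j \<le> n + 1" "i \<le> n - 1" using pairwise_hd assms(1) Cons.prems p by auto
  then have "brick n p \<in> lists (gens n)" by (auto simp: p brick_def hword_def set_asc set_dsc)
  then show ?case using Cons.IH pairwise_tl[OF assms(1) Cons.prems] by simp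
qed simp

lemma length_bricks:
  assumes "n \<ge> 1" "pairwise_ineqs n ps"
  shows "int (length (bricks n ps)) = (\<Sum>(j, i)\<leftarrow>ps. int n + 1 + int i + 1 - int j)"
  using assms(2)
proof (induction ps)
  case (Cons p ps)
  obtain j i where p: "p = (j, i)" by (cases p)
  have "j \<le> n + 1" using pairwise_hd(2) assms(1) Cons.prems p by auto
  then have "int (length (brick n p)) = int n + 1 + int i + 1 - int j"
    by (simp add: p brick_def hword_def asc_def dsc_def)
  then show ?case using Cons.IH pairwise_tl[OF assms(1) Cons.prems] by (simp add: p)
qed simp

lemma count_bricks:
  assumes "n \<ge> 1" "pairwise_ineqs n ps"
  shows "count_list (bricks n ps) (n + 1) = length ps"
  using assms(2)
proof (induction ps)
  case (Cons p ps)
  obtain j i where p: "p = (j, i)" by (cases p)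
  have "i \<le> n - 1" using pairwise_hd(3) assms(1) Cons.prems p by auto
  then have "n + 1 \<notin> set (asc j n @ dsc i 1)" using assms(1) by (auto simp: set_asc set_dsc)
  then have "count_list (brick n p) (n + 1) = 1"
    by (auto simp: p brick_def hword_def count_list_0_iff)
  then show ?case using Cons.IH pairwise_tl[OF assms(1) Cons.prems] by simp
qed simp

context
  fixes n :: nat
  assumes n: "n \<ge> 2"
begin

lemma n_ge_1: "n \<ge> 1" using n by simp

context
  fixes ps kl
  assumes ps: "pairwise_ineqs n ps" and kl: "canonical_indices n kl"
begin

lemma nf_lists: "bricks n ps @ ascs kl \<in> lists (gens n)"
  using bricks_lists[OF n_ge_1 ps] lists_sigma_gens[OF canonical_lists[OF kl]] by simp

lemma nf_reduced: "reduced n (bricks n ps @ ascs kl)"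
proof -
  have "ascending n (bricks n ps @ ascs kl) (base_vec n)"
    using bricks_invariant[OF n_ge_1 flat_ascs[OF kl] ps] up_ascs[OF kl] by (simp add: up_append)
  then show ?thesis
    using len_up[OF n alcove_base nf_lists] nf_lists by (simp only: reduced_iff[OF n] len_base) simp
qed

lemma nf_count: "count_list (bricks n ps @ ascs kl) (n + 1) = length ps"
proof -
  have "n + 1 \<notin> set (ascs kl)" using canonical_lists[OF kl] by (auto simp only: in_lists_conv_set atLeastAtMost_iff)
  then show ?thesis using count_bricks[OF n_ge_1 ps] by (simp only: count_list_append count_list_0_iff) simp
qed

text \<open>\<open>pos_part\<close> depends only on the element and bounds the affine letters of
  each of its expressions from below; the normal form attains the bound.\<close>

lemma nf_affine_length: "affine_length n (word_class n (bricks n ps @ ascs kl)) = length ps"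
  unfolding affine_length_def
proof (rule Least_equality)
  let ?x = "bricks n ps @ ascs kl"
  show "\<exists>x\<in>word_class n ?x. reduced n x \<and> count_list x (n + 1) = length ps"
    using nf_reduced nf_count nf_lists
    by (intro bexI[of _ ?x]) (simp_all only: mem_coxeter_class coxeter_rel.refl)
  fix k assume "\<exists>x\<in>word_class n ?x. reduced n x \<and> count_list x (n + 1) = k"
  then obtain y where y': "y \<in> word_class n ?x" and y: "count_list y (n + 1) = k" by blast
  have r: "rel n ?x y" using y' unfolding mem_coxeter_class .
  have "pos_part n (act n y (base_vec n)) = int (length ps)"
    using bricks_invariant[OF n_ge_1 flat_ascs[OF kl] ps] act_rel[OF n r, of "base_vec n"] by simp
  moreover have "pos_part n (base_vec n) = 0" by (rule pos_flat) (auto simp: flat_def base_vec_def)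
  ultimately show "length ps \<le> k"
    using pos_act_le[OF n_ge_1, of y "base_vec n"] coxeter_rel_lists[OF r] y by simp
qed

end

lemma nf_unique:
  assumes "pairwise_ineqs n ps" "canonical_indices n kl" "pairwise_ineqs n qs" "canonical_indices n ml"
    and "word_class n (bricks n ps @ ascs kl) = word_class n (bricks n qs @ ascs ml)"
  shows "ps = qs \<and> kl = ml"
proof -
  have "act n (bricks n ps) (act n (ascs kl) (base_vec n)) = act n (bricks n qs) (act n (ascs ml) (base_vec n))"
    using assms(5) unfolding word_class_eq_iff[OF n nf_lists[OF assms(1,2)] nf_lists[OF assms(3,4)]] by simp
  then show ?thesis
    using bricks_unique[OF n flat_ascs[OF assms(2)] flat_ascs[OF assms(4)] assms(1,3)]
      ascs_unique[OF n assms(2,4)] by blast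
qed

lemma nf_exists:
  assumes "w \<in> carrier (W_aff n)"
  obtains ps kl where "pairwise_ineqs n ps" "canonical_indices n kl"
    "word_class n (bricks n ps @ ascs kl) = w"
proof -
  obtain x where x: "x \<in> lists (gens n)" "w = word_class n x"
    using assms unfolding carrier_coxeter_group by blast
  have "alcove n (act n x (base_vec n))" by (rule alcove_act[OF n_ge_1 alcove_base x(1)])
  then obtain ps u where ps: "pairwise_ineqs n ps" "alcove n u" "flat n u"
      "act n (bricks n ps) u = act n x (base_vec n)"
    using bricks_exist[OF n] by blast
  have "u j = base_vec n j" if "j > n + 1" for j
    using ps(2) that by (auto simp: alcove_def)
  then obtain kl where kl: "canonical_indices n kl" "act n (ascs kl) (base_vec n) = u"
    using ascs_exist[OF n order_refl ps(2,3)] by blast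
  have "word_class n (bricks n ps @ ascs kl) = w"
    unfolding x(2) word_class_eq_iff[OF n nf_lists[OF ps(1) kl(1)] x(1)] using ps(4) kl(2) by simp
  then show ?thesis using that ps(1) kl(1) by blast
qed

lemma ascs_W_fin:
  assumes "x \<in> lists {1..n}"
  shows "word_class n x \<in> W_fin n"
  using assms
proof (induction x)
  case Nil
  show ?case unfolding W_fin_def one_coxeter_group[symmetric] by (rule generate.one)
next
  case (Cons s x)
  have "word_class n [s] \<in> W_fin n"
    unfolding W_fin_def by (rule generate.incl) (use Cons.hyps in simp)
  moreover have "word_class n (s # x) = word_class n [s] \<otimes>\<^bsub>W_aff n\<^esub> word_class n x"
    using mult_coxeter_class[of "[s]" "gens n" x "cmat n"] lists_sigma_gens[of x n] Cons.hyps by simp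
  ultimately show ?case using Cons.IH unfolding W_fin_def by (simp only: generate.eng)
qed

text \<open>Passes from canonical words to their index lists; \<open>ascs_W_fin\<close> provides the
  membership in \<open>W_fin n\<close>.\<close>

lemma normal_form_iff:
  "normal_form n w ps x \<longleftrightarrow>
     (\<exists>kl. x = ascs kl \<and> length ps = affine_length n w \<and> pairwise_ineqs n ps \<and>
       canonical_indices n kl \<and> word_class n (bricks n ps @ ascs kl) = w)" (is "?L \<longleftrightarrow> ?R")
proof
  assume ?L
  then show ?R unfolding normal_form_def canonical_expression_def by blast
next
  assume ?R
  then obtain kl where kl: "x = ascs kl" "canonical_indices n kl"
    and rest: "length ps = affine_length n w" "pairwise_ineqs n ps" "word_class n (bricks n ps @ x) = w"
    by blast
  have "word_class n x \<in> W_fin n" using ascs_W_fin[OF canonical_lists[OF kl(2)]] kl(1) by blast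
  then show ?L unfolding normal_form_def canonical_expression_def using kl rest by blast
qed

lemma nf_ex1:
  assumes "w \<in> carrier (W_aff n)"
  shows "\<exists>!(ps, kl). length ps = affine_length n w \<and> pairwise_ineqs n ps \<and> canonical_indices n kl \<and>
    word_class n (bricks n ps @ ascs kl) = w"
proof -
  obtain ps kl where nf: "pairwise_ineqs n ps" "canonical_indices n kl"
      "word_class n (bricks n ps @ ascs kl) = w"
    using nf_exists[OF assms] .
  have "length ps = affine_length n w" using nf_affine_length[OF nf(1,2)] nf(3) by metis
  moreover have "qs = ps \<and> ml = kl" if "pairwise_ineqs n qs" "canonical_indices n ml"
    "word_class n (bricks n qs @ ascs ml) = w" for qs ml
    using nf_unique[OF that(1,2) nf(1,2)] that(3) nf(3) by metis
  ultimately show ?thesis using nf by (intro ex1I[of _ "(ps, kl)"]) blast+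
qed

lemma normal_form_ex1:
  assumes "w \<in> carrier (W_aff n)"
  shows "\<exists>!(ps, x). normal_form n w ps x"
proof -
  obtain ps kl where nf: "normal_form n w ps (ascs kl)"
    and unique: "\<And>qs ml. length qs = affine_length n w \<Longrightarrow> pairwise_ineqs n qs \<Longrightarrow>
      canonical_indices n ml \<Longrightarrow> word_class n (bricks n qs @ ascs ml) = w \<Longrightarrow> qs = ps \<and> ml = kl"
    using nf_ex1[OF assms] unfolding normal_form_iff by blast
  show ?thesis
  proof (rule ex1I[of _ "(ps, ascs kl)"])
    show "case (ps, ascs kl) of (ps, x) \<Rightarrow> normal_form n w ps x" using nf by simp
    fix q assume "case q of (ps, x) \<Rightarrow> normal_form n w ps x"
    then have "normal_form n w (fst q) (snd q)" by (simp add: case_prod_beta)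
    then have "fst q = ps \<and> snd q = ascs kl" unfolding normal_form_iff using unique by blast
    then show "q = (ps, ascs kl)" by (simp add: prod_eq_iff)
  qed
qed

lemma normal_form_reduced:
  assumes "normal_form n w ps x"
  shows "reduced n (bricks n ps @ x)"
    and "int (coxeter_length w) = int (coxeter_length (word_class n x)) +
      (\<Sum>(j, i)\<leftarrow>ps. int n + 1 + int i + 1 - int j)"
proof -
  obtain kl where kl: "x = ascs kl" "pairwise_ineqs n ps" "canonical_indices n kl"
      "word_class n (bricks n ps @ ascs kl) = w"
    using assms unfolding normal_form_iff by blast
  \<comment> \<open>The instance without bricks shows that \<open>x\<close> alone is
    reduced.\<close>
  have r: "reduced n (bricks n ps @ x)" and "reduced n (bricks n [] @ x)"
    using nf_reduced[OF kl(2,3)] nf_reduced[OF pairwise_Nil kl(3)] kl(1) by simp_all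
  then have "coxeter_length w = length (bricks n ps @ x)" "coxeter_length (word_class n x) = length x"
    using kl by (simp_all add: reduced_word_def)
  then show "int (coxeter_length w) = int (coxeter_length (word_class n x)) +
      (\<Sum>(j, i)\<leftarrow>ps. int n + 1 + int i + 1 - int j)"
    using length_bricks[OF n_ge_1 kl(2)] by simp
  show "reduced n (bricks n ps @ x)" by (rule r)
qed

section \<open>Right descents and lengths of bricks\<close>

lemma descR_bricks:
  assumes ps: "pairwise_ineqs n ps" "length ps \<ge> 1"
  shows "descR n (word_class n (bricks n ps)) = {n + 1}"
proof -
  let ?x = "bricks n ps"
  have x: "?x \<in> lists (gens n)" by (rule bricks_lists[OF n_ge_1 ps(1)])
  have lx: "coxeter_length (word_class n ?x) = length ?x"
    using nf_reduced[OF ps(1) canonical_Nil] by (simp add: reduced_word_def)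
  have mult: "word_class n ?x \<otimes>\<^bsub>W_aff n\<^esub> word_class n [s] = word_class n (?x @ [s])" if "s \<in> gens n" for s
    by (rule mult_coxeter_class) (use x that in auto)
  \<comment> \<open>Appending the canonical word of the single pair \<open>(s, s)\<close> gives
    another normal form, which is therefore reduced.\<close>
  have ascending: "coxeter_length (word_class n (?x @ [s])) = length ?x + 1" if "s \<in> {1..n}" for s
    using nf_reduced[OF ps(1), of "[(s, s)]"] that
    by (simp add: reduced_word_def canonical_Cons canonical_Nil asc_def)
  obtain qs p where qs: "ps = qs @ [p]" using ps(2) by (cases ps rule: rev_cases) auto
  obtain y where y: "?x = y @ [n + 1]"
    using that[of "bricks n qs @ hword n (fst p) (snd p)"] by (simp add: qs brick_def case_prod_beta)
  have yl: "y \<in> lists (gens n)" and a: "n + 1 \<in> gens n" using x y by auto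
  \<comment> \<open>The last brick ends in the affine letter, so one more such letter cancels
    it.\<close>
  have "rel n (y @ [n + 1, n + 1] @ []) (y @ [])"
    by (rule coxeter_rel_append_left[OF _ yl]) (use rel_cancel[OF a, of "[]"] in simp)
  then have "word_class n (?x @ [n + 1]) = word_class n y"
    using coxeter_class_eq_iff[of "y @ [n + 1, n + 1]" "gens n" y "cmat n"] yl a y by simp
  then have "int (coxeter_length (word_class n (?x @ [n + 1]))) \<le> int (length y)"
    using coxeter_length_word_class[OF n yl] len_act_le[OF n yl] by simp
  then have down: "coxeter_length (word_class n (?x @ [n + 1])) < length ?x" using y by simp
  show ?thesis
  proof (rule Set.set_eqI)
    fix s
    show "s \<in> descR n (word_class n ?x) \<longleftrightarrow> s \<in> {n + 1}"
    proof (cases "s = n + 1")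
      case True
      then show ?thesis using mult[OF a] down lx a by (simp add: right_descents_def)
    next
      case False
      then show ?thesis using mult[of s] ascending[of s] lx by (auto simp: right_descents_def)
    qed
  qed
qed

lemma pairwise_antimono:
  assumes "pairwise_ineqs n ps" "a \<le> b" "b < length ps"
  shows "fst (ps ! b) \<le> fst (ps ! a)" "snd (ps ! a) \<le> snd (ps ! b)"
proof -
  have "fst (ps ! b) \<le> fst (ps ! a) \<and> snd (ps ! a) \<le> snd (ps ! b)"
    using assms(2,3)
  proof (induction b rule: dec_induct)
    case (step b)
    have "Suc (Suc b) \<in> {2..length ps}" using step.prems by simp
    then have "fst (ps ! Suc b) \<le> fst (ps ! b)" "snd (ps ! b) \<le> snd (ps ! Suc b)"
      using assms(1) unfolding pairwise_ineqs_def Let_def by fastforce+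
    then show ?case using step by simp
  qed simp
  then show "fst (ps ! b) \<le> fst (ps ! a)" "snd (ps ! a) \<le> snd (ps ! b)" by auto
qed

lemma pairwise_nth: "pairwise_ineqs n ps \<Longrightarrow> a < length ps \<Longrightarrow> pairwise_ineqs n [ps ! a]"
proof (induction ps arbitrary: a)
  case (Cons p ps)
  obtain j i where p: "p = (j, i)" by (cases p)
  show ?case
  proof (cases a)
    case 0
    then show ?thesis using pairwise_hd[OF n_ge_1, of j i ps] Cons.prems p by (simp add: pairwise_single)
  next
    case (Suc b)
    then show ?thesis using Cons.IH[of b] Cons.prems pairwise_tl[OF n_ge_1] by auto
  qed
qed simp

text \<open>The length is \<open>i - j\<close> up to a constant. Along the family \<open>i\<close>
  never falls and \<open>j\<close> never rises, so equal differences force equal pairs.\<close>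

lemma brick_length_inj:
  assumes ps: "pairwise_ineqs n ps" and "a < length ps" "b < length ps"
    and "coxeter_length (word_class n (brick n (ps ! a))) = coxeter_length (word_class n (brick n (ps ! b)))"
  shows "ps ! a = ps ! b"
proof -
  have l: "int (coxeter_length (word_class n (brick n (ps ! c)))) =
      int n + 2 + int (snd (ps ! c)) - int (fst (ps ! c))" if "c < length ps" for c
    using nf_reduced[OF pairwise_nth[OF ps that] canonical_Nil]
      length_bricks[OF n_ge_1 pairwise_nth[OF ps that]]
    by (simp add: reduced_word_def case_prod_beta)
  have e: "int (snd (ps ! a)) - int (fst (ps ! a)) = int (snd (ps ! b)) - int (fst (ps ! b))"
    using l[OF assms(2)] l[OF assms(3)] assms(4) by linarith
  show ?thesis
    using e pairwise_antimono[OF ps, of a b] pairwise_antimono[OF ps, of b a] assms(2,3)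
    by (intro prod_eqI) (cases "a \<le> b"; simp)+
qed

end

theorem theorem3p13:
  fixes n :: nat
  assumes "n \<ge> 2"
  shows
    "(\<forall>ps. length ps \<ge> 1 \<and> pairwise_ineqs n ps \<longrightarrow>
        reduced n (bricks n ps) \<and>
        affine_length_reduced n (bricks n ps) \<and>
        descR n (word_class n (bricks n ps)) = {n + 1})
     \<and>
     (\<forall>w\<in>carrier (W_aff n). affine_length n w \<ge> 1 \<longrightarrow>
        (\<exists>!(ps, x). normal_form n w ps x) \<and>
        (\<forall>ps x. normal_form n w ps x \<longrightarrow>
           reduced n (bricks n ps @ x) \<and>
           int (coxeter_length w) =
             int (coxeter_length (word_class n x)) +
             (\<Sum>(j, i)\<leftarrow>ps. int n + 1 + int i + 1 - int j)))
     \<and>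
     (\<forall>ps. pairwise_ineqs n ps \<longrightarrow>
        (\<forall>r\<in>{1..length ps}. \<forall>s\<in>{1..length ps}.
           coxeter_length (word_class n (brick n (ps ! (s - 1)))) =
           coxeter_length (word_class n (brick n (ps ! (r - 1)))) \<longleftrightarrow>
           brick n (ps ! (s - 1)) = brick n (ps ! (r - 1))))
     \<and>
     (\<forall>w\<in>carrier (W_aff n). affine_length n w \<ge> 1 \<longrightarrow>
        (\<exists>!(ps, kl).
           length ps = affine_length n w \<and> pairwise_ineqs n ps \<and> canonical_indices n kl \<and>
           word_class n (bricks n ps @ ascs kl) = w) \<and>
        (\<forall>ps kl.
           length ps = affine_length n w \<and> pairwise_ineqs n ps \<and> canonical_indices n kl \<and>
           word_class n (bricks n ps @ ascs kl) = w \<longrightarrow>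
           reduced n (bricks n ps @ ascs kl)))"
proof (intro conjI)
  show "\<forall>ps. length ps \<ge> 1 \<and> pairwise_ineqs n ps \<longrightarrow>
      reduced n (bricks n ps) \<and> affine_length_reduced n (bricks n ps) \<and>
      descR n (word_class n (bricks n ps)) = {n + 1}"
  proof (intro allI impI, elim conjE)
    fix ps assume ps: "length ps \<ge> 1" "pairwise_ineqs n ps"
    note Nil = canonical_Nil[of n]
    have "reduced n (bricks n ps)" using nf_reduced[OF assms ps(2) Nil] by simp
    moreover have "affine_length_reduced n (bricks n ps)"
      using nf_reduced[OF assms ps(2) Nil] nf_count[OF assms ps(2) Nil]
        nf_affine_length[OF assms ps(2) Nil] by (simp add: affine_length_reduced_def)
    ultimately show "reduced n (bricks n ps) \<and> affine_length_reduced n (bricks n ps) \<and>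
        descR n (word_class n (bricks n ps)) = {n + 1}"
      using descR_bricks[OF assms ps(2,1)] by blast
  qed
next
  show "\<forall>ps. pairwise_ineqs n ps \<longrightarrow>
      (\<forall>r\<in>{1..length ps}. \<forall>s\<in>{1..length ps}.
         coxeter_length (word_class n (brick n (ps ! (s - 1)))) =
         coxeter_length (word_class n (brick n (ps ! (r - 1)))) \<longleftrightarrow>
         brick n (ps ! (s - 1)) = brick n (ps ! (r - 1)))"
  proof (intro allI impI ballI iffI)
    fix ps r s
    assume "pairwise_ineqs n ps" "r \<in> {1..length ps}" "s \<in> {1..length ps}"
      "coxeter_length (word_class n (brick n (ps ! (s - 1)))) =
         coxeter_length (word_class n (brick n (ps ! (r - 1))))"
    then have "ps ! (s - 1) = ps ! (r - 1)"
      by (intro brick_length_inj[OF assms]) auto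
    then show "brick n (ps ! (s - 1)) = brick n (ps ! (r - 1))" by simp
  qed simp
next
  show "\<forall>w\<in>carrier (W_aff n). affine_length n w \<ge> 1 \<longrightarrow>
      (\<exists>!(ps, x). normal_form n w ps x) \<and>
      (\<forall>ps x. normal_form n w ps x \<longrightarrow>
         reduced n (bricks n ps @ x) \<and>
         int (coxeter_length w) =
           int (coxeter_length (word_class n x)) +
           (\<Sum>(j, i)\<leftarrow>ps. int n + 1 + int i + 1 - int j))"
    by (intro ballI impI conjI allI)
      (erule normal_form_ex1[OF assms] normal_form_reduced[OF assms])+
  show "\<forall>w\<in>carrier (W_aff n). affine_length n w \<ge> 1 \<longrightarrow>
      (\<exists>!(ps, kl).
         length ps = affine_length n w \<and> pairwise_ineqs n ps \<and> canonical_indices n kl \<and>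
         word_class n (bricks n ps @ ascs kl) = w) \<and>
      (\<forall>ps kl.
         length ps = affine_length n w \<and> pairwise_ineqs n ps \<and> canonical_indices n kl \<and>
         word_class n (bricks n ps @ ascs kl) = w \<longrightarrow>
         reduced n (bricks n ps @ ascs kl))"
    by (intro ballI impI conjI allI; (elim conjE)?)
      (erule nf_ex1[OF assms], erule (1) nf_reduced[OF assms])
qed

end
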